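(* Let $A\in\mathbb{R}^{n\times n}$ be Hurwitz, $B\in\mathbb{R}^{n\times m}$, $C\in\mathbb{R}^{p\times n}$, and consider the linear system $\dot x = Ax+Bu$, $y=Cx$ with $x\in\mathbb{R}^n$, $u\in\mathbb{R}^m$, $y\in\mathbb{R}^p$. Let $G(s)=C(sI-A)^{-1}B$ be its transfer matrix and, for $T>0$, let $$H_T(t)=\sum_{k=0}^\infty C e^{A(t+kT)}B = C e^{At}(I-e^{AT})^{-1}B,\qquad t\in[0,T],$$ be its $T$-periodic-impulse response. Then for every $T>0$ the exact period-aware asymptotic gain (PAG) of the system is $$\gamma_T\big(\rho_T(u)\big)=\Gamma_T\,\rho_T(u),\qquad \Gamma_T=\begin{bmatrix}\gamma_{\mathrm{dc}}&0\\0&\gamma_{\mathrm{ac}}(T)\end{bmatrix},$$ where $$\gamma_{\mathrm{dc}}=\|G(0)\|,\qquad \gamma_{\mathrm{ac}}(T)=T\sup_{v\in\mathbb{R}^p,\ \|v\|=1}D_{\mathrm{med}}(v\cdot H_T),$$ and $v\cdot H_T$ denotes the $\mathbb{R}^m$-valued function $t\mapsto v^{\mathsf T}H_T(t)$ on $[0,T]$.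
   Context: Norms: $\|x\|$ is the Euclidean norm of a vector, $\|M\|=\max_{\|x\|=1}\|Mx\|$ the induced matrix norm, $\|x\|_1=\sum_k|x_k|$, and $\|f\|_\infty=\operatorname{ess\,sup}_t\|f(t)\|$. The relation $x\preceq y$ means $x_k\le y_k$ for all components $k$. Moving average: $\langle f\rangle_T(t)=\frac1T\int_{t-T}^t f(\tau)\,d\tau$. Asymptotic AC/DC magnitude: $$\rho_T(f)=\begin{bmatrix}\operatorname{ess\,lim\,sup}_{t\to\infty}\|\langle f\rangle_T(t)\|\\ \operatorname{ess\,lim\,sup}_{t\to\infty}\|f(t)-\langle f\rangle_T(t)\|\end{bmatrix}\in\mathbb{R}^2.$$ If $f$ is $T$-periodic, put $f_{\mathrm{dc}}=\langle f\rangle_T$ (a constant) and $f_{\mathrm{ac}}=f-f_{\mathrm{dc}}$; then $\rho_T(f)=(\|f_{\mathrm{dc}}\|,\|f_{\mathrm{ac}}\|_\infty)^{\mathsf T}$. Mean absolute deviation from the geometric median: for $f\in L^\infty([0,T],\mathbb{R}^m)$, $$D_{\mathrm{med}}f=\min_{\mu\in\mathbb{R}^m}\frac1T\int_0^T\|f(t)-\mu\|\,dt.$$ Fix an open set $\mathcal X_0\subset\mathbb{R}^n$ of initial states with $0\in\mathcal X_0$ and an input bound $u_{\max}\in(0,\infty]$, and let $\mathcal U_T$ be the set of $T$-periodic $u\in L^\infty(\mathbb{R},\mathbb{R}^m)$ with $\|\rho_T(u)\|_1<u_{\max}$. A function $\gamma_T:[0,u_{\max})^2\to[0,\infty)^2$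 that is non-decreasing with respect to $\preceq$ is a (conservative) period-aware asymptotic gain (PAG) if for every $u\in\mathcal U_T$ and $x(0)\in\mathcal X_0$ the output $y(t)$, $t\ge0$, satisfies $\rho_T(y)\preceq\gamma_T(\rho_T(u))$. The exact PAG is the $\preceq$-minorant (componentwise pointwise infimum) of all conservative PAGs. *)

theory Defs
  imports "HOL-Analysis.Analysis" "HOL-Probability.Essential_Supremum"
begin

definition essbounded :: "(real \<Rightarrow> 'a::euclidean_space) \<Rightarrow> bool" where
  "essbounded f \<longleftrightarrow> f \<in> borel_measurable lebesgue \<and> esssup lebesgue (\<lambda>t. ereal (norm (f t))) < \<infinity>"

definition moving_avg :: "real \<Rightarrow> (real \<Rightarrow> 'a::euclidean_space) \<Rightarrow> real \<Rightarrow> 'a" where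
  "moving_avg T f t = (1 / T) *\<^sub>R integral {t - T..t} f"

text \<open>The tail suprema decrease in \<open>s\<close>, so the infimum is their limit as \<open>s\<close> tends to infinity;
  in particular only the restriction of \<open>g\<close> to large times matters.\<close>

definition ess_limsup :: "(real \<Rightarrow> ereal) \<Rightarrow> ereal" where
  "ess_limsup g = (INF s. esssup (lebesgue_on {s..}) g)"

text \<open>The values are extended reals so that an unbounded signal has magnitude \<open>\<infinity>\<close> rather than
  an arbitrary real one. Component 1 is the DC part, component 2 the AC part.\<close>

definition acdc_mag :: "real \<Rightarrow> (real \<Rightarrow> 'a::euclidean_space) \<Rightarrow> ereal ^ 2" where
  "acdc_mag T f = vector
     [ess_limsup (\<lambda>t. ereal (norm (moving_avg T f t))),
      ess_limsup (\<lambda>t. ereal (norm (f t - moving_avg T f t)))]"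

definition real_vec :: "ereal ^ 'i \<Rightarrow> real ^ 'i" where
  "real_vec r = (\<chi> i. real_of_ereal (r $ i))"

definition ereal_vec :: "real ^ 'i \<Rightarrow> ereal ^ 'i" where
  "ereal_vec r = (\<chi> i. ereal (r $ i))"

definition periodic_inputs :: "real \<Rightarrow> ereal \<Rightarrow> (real \<Rightarrow> real ^ 'm) set" where
  "periodic_inputs T umax =
     {u. essbounded u \<and> (\<forall>t. u (t + T) = u t) \<and> (\<Sum>i\<in>UNIV. \<bar>acdc_mag T u $ i\<bar>) < umax}"

text \<open>A system is given by its input/initial state/output relation: \<open>S u x0 y\<close> says that \<open>y\<close> is
  an output on \<open>t \<ge> 0\<close> for the input \<open>u\<close> and the initial state \<open>x0\<close>; the values of \<open>y\<close> at
  negative times are irrelevant.\<close>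

type_synonym ('m, 'n, 'p) io_system =
  "(real \<Rightarrow> real ^ 'm) \<Rightarrow> real ^ 'n \<Rightarrow> (real \<Rightarrow> real ^ 'p) \<Rightarrow> bool"

definition gain_domain :: "ereal \<Rightarrow> (real ^ 2) set" where
  "gain_domain umax = {r. \<forall>i. 0 \<le> r $ i \<and> ereal (r $ i) < umax}"

text \<open>The order on vectors is componentwise. The magnitude of an essentially bounded input is
  finite, so \<^const>\<open>real_vec\<close> loses nothing here. A gain is only meaningful on
  \<^const>\<open>gain_domain\<close>; its values elsewhere are unconstrained.\<close>

definition is_PAG ::
  "('m::finite, 'n::finite, 'p::finite) io_system \<Rightarrow> (real ^ 'n) set \<Rightarrow> ereal \<Rightarrow> real
    \<Rightarrow> (real ^ 2 \<Rightarrow> real ^ 2) \<Rightarrow> bool" where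
  "is_PAG S X0 umax T \<gamma> \<longleftrightarrow>
     (\<forall>r\<in>gain_domain umax. 0 \<le> \<gamma> r) \<and>
     mono_on (gain_domain umax) \<gamma> \<and>
     (\<forall>u\<in>periodic_inputs T umax. \<forall>x0\<in>X0. \<forall>y. S u x0 y \<longrightarrow>
        acdc_mag T y \<le> ereal_vec (\<gamma> (real_vec (acdc_mag T u))))"

text \<open>The first conjunct keeps the infimum away from the empty set; the infimum is over
  nonnegative reals on the domain.\<close>

definition is_exact_PAG ::
  "('m::finite, 'n::finite, 'p::finite) io_system \<Rightarrow> (real ^ 'n) set \<Rightarrow> ereal \<Rightarrow> real
    \<Rightarrow> (real ^ 2 \<Rightarrow> real ^ 2) \<Rightarrow> bool" where
  "is_exact_PAG S X0 umax T \<gamma> \<longleftrightarrow>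
     {\<gamma>'. is_PAG S X0 umax T \<gamma>'} \<noteq> {} \<and>
     (\<forall>r\<in>gain_domain umax. \<forall>i. \<gamma> r $ i = (INF \<gamma>'\<in>{\<gamma>'. is_PAG S X0 umax T \<gamma>'}. \<gamma>' r $ i))"

definition hurwitz :: "real ^ 'n ^ 'n \<Rightarrow> bool" where
  "hurwitz A \<longleftrightarrow>
     (\<forall>z::complex. (\<exists>v. v \<noteq> 0 \<and> map_matrix complex_of_real A *v v = z *s v) \<longrightarrow> Re z < 0)"

text \<open>Inputs are only essentially bounded, so solutions are Caratheodory solutions: absolutely
  continuous functions satisfying the differential equation almost everywhere, written here in the
  integral form.\<close>

definition lti_system ::
  "real ^ 'n ^ 'n \<Rightarrow> real ^ 'm ^ 'n \<Rightarrow> real ^ 'n ^ 'p \<Rightarrow> ('m::finite, 'n::finite, 'p::finite) io_system"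
  where
  "lti_system A B C u x0 y \<longleftrightarrow>
     (\<exists>x. (\<forall>t\<ge>0. (\<lambda>s. A *v x s + B *v u s) absolutely_integrable_on {0..t} \<and>
                  x t = x0 + integral {0..t} (\<lambda>s. A *v x s + B *v u s) \<and>
                  y t = C *v x t))"

text \<open>The type \<open>real ^ 'n ^ 'n\<close> is not an instance of the class on which \<^const>\<open>exp\<close> is defined.\<close>

definition matrix_exp :: "real ^ 'n ^ 'n \<Rightarrow> real ^ 'n ^ 'n" where
  "matrix_exp A = (\<Sum>k. (1 / fact k) *\<^sub>R (((**) A ^^ k) (mat 1)))"

definition transfer_matrix ::
  "real ^ 'n ^ 'n \<Rightarrow> real ^ 'm ^ 'n \<Rightarrow> real ^ 'n ^ 'p \<Rightarrow> complex \<Rightarrow> complex ^ 'm ^ 'p" where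
  "transfer_matrix A B C s =
     map_matrix complex_of_real C ** matrix_inv (mat s - map_matrix complex_of_real A)
       ** map_matrix complex_of_real B"

definition periodic_impulse_response ::
  "real ^ 'n ^ 'n \<Rightarrow> real ^ 'm ^ 'n \<Rightarrow> real ^ 'n ^ 'p \<Rightarrow> real \<Rightarrow> real \<Rightarrow> real ^ 'm ^ 'p" where
  "periodic_impulse_response A B C T t =
     (\<Sum>k. C ** matrix_exp ((t + real k * T) *\<^sub>R A) ** B)"

text \<open>The infimum is a minimum: the objective is continuous and coercive in \<open>\<mu>\<close>.\<close>

definition D_med :: "real \<Rightarrow> (real \<Rightarrow> real ^ 'm) \<Rightarrow> real" where
  "D_med T f = (INF \<mu>. (1 / T) * integral {0..T} (\<lambda>t. norm (f t - \<mu>)))"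

definition gamma_dc ::
  "real ^ 'n ^ 'n \<Rightarrow> real ^ 'm ^ 'n \<Rightarrow> real ^ 'n ^ 'p \<Rightarrow> real" where
  "gamma_dc A B C = onorm ((*v) (transfer_matrix A B C 0))"

definition gamma_ac ::
  "real ^ 'n ^ 'n \<Rightarrow> real ^ 'm ^ 'n \<Rightarrow> real ^ 'n ^ 'p \<Rightarrow> real \<Rightarrow> real" where
  "gamma_ac A B C T =
     T * (SUP v\<in>sphere 0 1. D_med T (\<lambda>t. v v* periodic_impulse_response A B C T t))"

definition gain_matrix ::
  "real ^ 'n ^ 'n \<Rightarrow> real ^ 'm ^ 'n \<Rightarrow> real ^ 'n ^ 'p \<Rightarrow> real \<Rightarrow> real ^ 2 ^ 2" where
  "gain_matrix A B C T = vector
     [vector [gamma_dc A B C, 0],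
      vector [0, gamma_ac A B C T]]"

end

theory Submission
  imports Defs "HOL-Computational_Algebra.Fundamental_Theorem_Algebra"
begin

text \<open>
  After a transient the output is the periodic function \<open>\<integral> H\<^sub>T(t - s) u(s) ds\<close>, integrated over one
  period. Since the integral of \<open>H\<^sub>T\<close> is \<open>G(0)\<close>, its mean is \<open>G(0)\<close> applied to the mean of \<open>u\<close>, and its
  AC part is the response to the AC part \<open>w\<close> of \<open>u\<close>. In a direction \<open>v\<close> one may subtract any constant \<open>\<mu>\<close>
  from \<open>v \<cdot> H\<^sub>T\<close> because \<open>w\<close> has mean zero, so the AC part is at most
  \<open>\<parallel>w\<parallel>\<^sub>\<infinity>\<close> times the integral of \<open>norm (v \<cdot> H\<^sub>T - \<mu>)\<close>. Conversely, the first-order condition at a minimiser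
  \<open>\<mu>\<close> of a smoothed mean deviation says that the smoothed unit vector field of \<open>v \<cdot> H\<^sub>T - \<mu>\<close> has mean zero;
  reversed in time, it is an input that attains the bound up to an arbitrarily small error. The DC and the
  AC bound are approached by inputs with vanishing AC and DC part respectively, which is why the exact gain is
  diagonal even where no admissible input has both magnitudes at once.
\<close>

section \<open>The matrix exponential\<close>

text \<open>\<open>hurwitz\<close> speaks of eigenvalues only, but is used chiefly to make
  transients die out. The bridge avoids normal forms: every single vector is annihilated by some
  product of factors A - z, and removing these factors one at a time reduces the flow of the vector
  to scalar equations with decaying forcing. Convergence of the flow to 0 then already yields the
  invertibility of \<open>mat 1 - matrix_exp (T *\<^sub>R A)\<close> and the sum of the geometric
  series behind the periodic impulse response. Inputs are merely essentially bounded, so a solution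
  need not be differentiable everywhere; its integral equation is handled by an integration by parts
  for Lipschitz functions. Magnitudes ignore null sets, but outputs are continuous, which makes
  their values at single sampling instants count. The norm is smoothed because the unit vector field
  is undefined where f - \<mu> vanishes, and there the mean deviation offers only a subgradient
  condition instead of an equation.\<close>

lemma bounded_bilinear_matrix_vector_mult:
  "bounded_bilinear ((*v) :: real ^ 'n ^ 'm \<Rightarrow> real ^ 'n \<Rightarrow> real ^ 'm)"
  unfolding bilinear_conv_bounded_bilinear[symmetric] bilinear_def
  by (intro conjI allI linearI)
    (auto simp: matrix_vector_mult_def vec_eq_iff sum.distrib algebra_simps sum_distrib_left)

lemma bounded_bilinear_matrix_matrix_mult:
  "bounded_bilinear ((**) :: real ^ 'n ^ 'm \<Rightarrow> real ^ 'k ^ 'n \<Rightarrow> real ^ 'k ^ 'm)"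
  unfolding bilinear_conv_bounded_bilinear[symmetric] bilinear_def
  by (intro conjI allI linearI)
    (auto simp: matrix_matrix_mult_def vec_eq_iff sum.distrib algebra_simps sum_distrib_left)

lemma bounded_bilinear_vector_matrix_mult:
  "bounded_bilinear ((v*) :: real ^ 'm \<Rightarrow> real ^ 'n ^ 'm \<Rightarrow> real ^ 'n)"
  unfolding bilinear_conv_bounded_bilinear[symmetric] bilinear_def
  by (intro conjI allI linearI)
    (auto simp: vector_matrix_mult_def vec_eq_iff sum.distrib algebra_simps sum_distrib_left)

interpretation mv: bounded_bilinear "(*v) :: real ^ 'n ^ 'm \<Rightarrow> real ^ 'n \<Rightarrow> real ^ 'm"
  by (rule bounded_bilinear_matrix_vector_mult)

interpretation mm: bounded_bilinear "(**) :: real ^ 'n ^ 'm \<Rightarrow> real ^ 'k ^ 'n \<Rightarrow> real ^ 'k ^ 'm"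
  by (rule bounded_bilinear_matrix_matrix_mult)

abbreviation matrix_pow :: "real ^ 'n ^ 'n \<Rightarrow> nat \<Rightarrow> real ^ 'n ^ 'n" where
  "matrix_pow A k \<equiv> ((**) A ^^ k) (mat 1)"

lemma matrix_pow_scaleR: "matrix_pow (t *\<^sub>R A) k = t ^ k *\<^sub>R matrix_pow A k"
  by (induction k) (simp_all add: mm.scaleR_left mm.scaleR_right mult.commute)

lemma matrix_pow_commute: "matrix_pow A k ** A = A ** matrix_pow A k"
  by (induction k) (simp_all add: matrix_mul_assoc[symmetric])

text \<open>Bilinearity bounds the norm of a product only up to a constant \<open>K\<close>;
  absorbing \<open>K\<close> into the base of the power keeps the majorant an exponential
  series.\<close>

lemma summable_matrix_exp:
  fixes A :: "real ^ 'n ^ 'n"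
  shows "summable (\<lambda>k. norm ((1 / fact k) *\<^sub>R matrix_pow A k))"
proof -
  obtain K where K: "K > 0" "\<And>(X :: real^'n^'n) (Y :: real^'n^'n). norm (X ** Y) \<le> norm X * norm Y * K"
    using mm.pos_bounded by blast
  have pow: "norm (matrix_pow A k) \<le> (K * norm A) ^ k * norm (mat 1 :: real^'n^'n)" for k
  proof (induction k)
    case (Suc k)
    have "norm (matrix_pow A (Suc k)) \<le> (norm A * K) * norm (matrix_pow A k)"
      using K(2)[of A "matrix_pow A k"] by (simp add: mult_ac)
    also have "\<dots> \<le> (norm A * K) * ((K * norm A) ^ k * norm (mat 1 :: real^'n^'n))"
      using K(1) Suc by (intro mult_left_mono) auto
    finally show ?case by (simp add: mult_ac)
  qed auto
  have "summable (\<lambda>k. (K * norm A) ^ k /\<^sub>R fact k * norm (mat 1 :: real^'n^'n))"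
    by (intro summable_mult2 summable_exp_generic)
  then show ?thesis
  proof (rule summable_comparison_test[rotated], intro exI allI impI)
    fix k
    have "norm (matrix_pow A k) / fact k \<le> (K * norm A) ^ k * norm (mat 1 :: real^'n^'n) / fact k"
      using pow[of k] by (intro divide_right_mono) auto
    then show "norm (norm ((1 / fact k) *\<^sub>R matrix_pow A k))
        \<le> (K * norm A) ^ k /\<^sub>R fact k * norm (mat 1 :: real^'n^'n)"
      by (simp add: field_simps)
  qed
qed

lemma sums_matrix_exp: "(\<lambda>k. (1 / fact k) *\<^sub>R matrix_pow A k) sums matrix_exp A"
  unfolding matrix_exp_def by (rule summable_sums[OF summable_norm_cancel[OF summable_matrix_exp]])

lemma sums_matrix_exp_scaleR:
  "(\<lambda>k. (t ^ k / fact k) *\<^sub>R matrix_pow A k) sums matrix_exp (t *\<^sub>R A)"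
  using sums_matrix_exp[of "t *\<^sub>R A"] by (simp add: matrix_pow_scaleR)

lemma sums_matrix_exp_mult_left:
  "(\<lambda>k. (t ^ k / fact k) *\<^sub>R matrix_pow A (Suc k)) sums (A ** matrix_exp (t *\<^sub>R A))"
  using bounded_linear.sums[OF mm.bounded_linear_right[of A] sums_matrix_exp_scaleR]
  by (simp add: mm.scaleR_right)

lemma matrix_exp_commute: "matrix_exp (t *\<^sub>R A) ** A = A ** matrix_exp (t *\<^sub>R A)"
proof -
  have "(\<lambda>k. (t ^ k / fact k) *\<^sub>R matrix_pow A (Suc k)) sums (matrix_exp (t *\<^sub>R A) ** A)"
    using bounded_linear.sums[OF mm.bounded_linear_left[of A] sums_matrix_exp_scaleR[of t A]]
    by (simp add: mm.scaleR_left matrix_pow_commute)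
  then show ?thesis
    using sums_matrix_exp_mult_left sums_unique2 by blast
qed

lemma matrix_exp_0 [simp]: "matrix_exp (0 :: real ^ 'n ^ 'n) = mat 1"
proof -
  have "(\<lambda>k. (0 ^ k / fact k) *\<^sub>R matrix_pow (0 :: real^'n^'n) k) sums
      (\<Sum>k\<in>{0}. (0 ^ k / fact k) *\<^sub>R matrix_pow (0 :: real^'n^'n) k)"
    by (intro sums_finite) auto
  then show ?thesis
    using sums_matrix_exp_scaleR[of 0 "0 :: real^'n^'n"] sums_unique2 by fastforce
qed

text \<open>Each entry is an everywhere convergent real power series in t, so it may be
  differentiated termwise; the shift of coefficients by \<open>diffs\<close> is multiplication by
  A.\<close>

lemma has_vector_derivative_matrix_exp:
  "((\<lambda>t. matrix_exp (t *\<^sub>R A)) has_vector_derivative A ** matrix_exp (t *\<^sub>R A)) (at t within S)"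
proof -
  have nth2: "bounded_linear (\<lambda>X :: real^'n^'n. X $ i $ j)" for i j
    by (intro bounded_linear_compose[OF bounded_linear_vec_nth] bounded_linear_vec_nth)
  have comp: "((\<lambda>t. matrix_exp (t *\<^sub>R A) $ i $ j) has_real_derivative
      (A ** matrix_exp (t *\<^sub>R A)) $ i $ j) (at t within S)" for i j
  proof -
    define c where "c k = matrix_pow A k $ i $ j / fact k" for k
    have c: "(\<lambda>k. c k * s ^ k) sums (matrix_exp (s *\<^sub>R A) $ i $ j)" for s
      using bounded_linear.sums[OF nth2 sums_matrix_exp_scaleR[of s A], of i j]
      by (simp add: c_def mult.commute)
    have d: "(\<lambda>k. diffs c k * s ^ k) sums ((A ** matrix_exp (s *\<^sub>R A)) $ i $ j)" for s
      using bounded_linear.sums[OF nth2 sums_matrix_exp_mult_left[of s A], of i j]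
      by (simp add: c_def diffs_def field_simps del: of_nat_Suc)
    have "((\<lambda>t. \<Sum>k. c k * t ^ k) has_real_derivative (\<Sum>k. diffs c k * t ^ k)) (at t)"
      using c by (intro termdiffs_strong_converges_everywhere) (auto simp: sums_iff)
    then show ?thesis
      using c d by (simp add: sums_iff has_field_derivative_at_within)
  qed
  show ?thesis
    unfolding has_vector_derivative_def
    by (subst has_derivative_componentwise_within)
      (use comp in \<open>auto simp: Basis_vec_def inner_axis has_field_derivative_def mult_commute_abs\<close>)
qed

lemma has_vector_derivative_matrix_exp_compose:
  assumes "(g has_real_derivative g') (at t within S)"
  shows "((\<lambda>t. matrix_exp (g t *\<^sub>R A)) has_vector_derivative
    g' *\<^sub>R (A ** matrix_exp (g t *\<^sub>R A))) (at t within S)"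
  using vector_diff_chain_within[OF assms[unfolded has_real_derivative_iff_has_vector_derivative]
      has_vector_derivative_matrix_exp]
  by (simp add: o_def)

lemma continuous_on_matrix_exp [continuous_intros]:
  assumes "continuous_on S g"
  shows "continuous_on S (\<lambda>t. matrix_exp (g t *\<^sub>R A))"
proof -
  have "continuous_on UNIV (\<lambda>t. matrix_exp (t *\<^sub>R A))"
    by (rule continuous_on_vector_derivative, rule has_vector_derivative_matrix_exp)
  then show ?thesis
    by (rule continuous_on_compose2[OF _ assms]) auto
qed

text \<open>As a function of t the left side has derivative zero, because A commutes with its
  exponential and the two terms of the product rule cancel; at t = 0 it equals the right side. This
  one identity contains both the inverse (s = 0) and the group law.\<close>

lemma matrix_exp_add_aux: "matrix_exp ((- t) *\<^sub>R A) ** matrix_exp ((s + t) *\<^sub>R A) = matrix_exp (s *\<^sub>R A)"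
proof -
  let ?f = "\<lambda>t. matrix_exp ((- t) *\<^sub>R A) ** matrix_exp ((s + t) *\<^sub>R A)"
  have "(?f has_vector_derivative 0) (at r within UNIV)" for r
  proof -
    have "(?f has_vector_derivative
        matrix_exp ((- r) *\<^sub>R A) ** (1 *\<^sub>R (A ** matrix_exp ((s + r) *\<^sub>R A)))
        + ((- 1) *\<^sub>R (A ** matrix_exp ((- r) *\<^sub>R A))) ** matrix_exp ((s + r) *\<^sub>R A)) (at r within UNIV)"
      by (intro mm.has_vector_derivative has_vector_derivative_matrix_exp_compose)
        (auto intro!: derivative_eq_intros)
    then show ?thesis
      by (simp add: mm.minus_left matrix_mul_assoc matrix_exp_commute[of "- r" A, simplified])
  qed
  then obtain c where c: "\<And>r. ?f r = c"
    using has_vector_derivative_zero_constant[of UNIV ?f] by auto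
  show ?thesis
    using c[of t] c[of 0] by simp
qed

lemma matrix_exp_minus: "matrix_exp ((- t) *\<^sub>R A) ** matrix_exp (t *\<^sub>R A) = mat 1"
  "matrix_exp (t *\<^sub>R A) ** matrix_exp ((- t) *\<^sub>R A) = mat 1"
  using matrix_exp_add_aux[of t A 0] matrix_exp_add_aux[of "- t" A 0] by simp_all

lemma matrix_exp_add: "matrix_exp ((s + t) *\<^sub>R A) = matrix_exp (s *\<^sub>R A) ** matrix_exp (t *\<^sub>R A)"
proof -
  have "matrix_exp (s *\<^sub>R A) ** matrix_exp (t *\<^sub>R A)
      = matrix_exp (s *\<^sub>R A) ** (matrix_exp ((- s) *\<^sub>R A) ** matrix_exp ((t + s) *\<^sub>R A))"
    by (simp only: matrix_exp_add_aux)
  then show ?thesis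
    by (simp only: matrix_mul_assoc matrix_exp_minus matrix_mul_lid add.commute)
qed

lemma matrix_exp_of_nat_mult: "matrix_exp ((real k * t) *\<^sub>R A) = matrix_pow (matrix_exp (t *\<^sub>R A)) k"
  by (induction k) (simp_all add: distrib_right matrix_exp_add)

section \<open>Decay of the flow of a Hurwitz matrix\<close>

abbreviation complex_matrix :: "real ^ 'n ^ 'm \<Rightarrow> complex ^ 'n ^ 'm" where
  "complex_matrix \<equiv> map_matrix complex_of_real"

text \<open>The constants are existential because each factor of an annihilating product may worsen
  the rate.\<close>

definition exp_decaying :: "(real \<Rightarrow> 'a::real_normed_vector) \<Rightarrow> bool" where
  "exp_decaying f \<longleftrightarrow> (\<exists>K c. 0 < c \<and> (\<forall>t\<ge>0. norm (f t) \<le> K * exp (- (c * t))))"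

lemma norm_complex_smult: "norm (c *s (v :: complex ^ 'n)) = norm c * norm v"
  by (simp add: norm_vec_def norm_mult L2_set_right_distrib)

lemma bounded_bilinear_complex_smult:
  "bounded_bilinear ((*s) :: complex \<Rightarrow> complex ^ 'n \<Rightarrow> complex ^ 'n)"
  by (rule bounded_bilinear.intro)
    (auto simp: vec_eq_iff algebra_simps norm_complex_smult intro!: exI[of _ 1])

text \<open>The integrating factor exp (- t z) removes the homogeneous part, so the derivative of
  \<open>y\<close> is the weighted forcing alone and its norm can be integrated.\<close>

lemma exp_decaying_forced:
  fixes x g :: "real \<Rightarrow> complex ^ 'n"
  assumes x: "\<And>t. (x has_vector_derivative z *s x t + g t) (at t)"
    and z: "Re z < 0" and g: "exp_decaying g"
  shows "exp_decaying x"
proof -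
  obtain K c where c: "0 < c" and K: "\<And>t. 0 \<le> t \<Longrightarrow> norm (g t) \<le> K * exp (- (c * t))"
    using g unfolding exp_decaying_def by blast
  have "norm (g 0) \<le> K" using K[of 0] by simp
  then have K0: "0 \<le> K" using norm_ge_zero order_trans by blast
  \<comment> \<open>A rate strictly below both c and - Re z makes a positive and bounds the weighted
    forcing by \<open>K * exp (a * s)\<close>. This covers the resonance c = - Re z too, where the
    sharp bound carries an extra factor t.\<close>
  define d where "d = min c (- Re z) / 2"
  define a where "a = - Re z - d"
  have d: "0 < d" "d < c" "0 < a"
    using c z by (auto simp: d_def a_def min_def)
  define y where "y t = exp (- (t *\<^sub>R z)) *s x t" for t
  have norm_e: "norm (exp (- (t *\<^sub>R z))) = exp (- (t * Re z))" for t
    by (simp add: norm_exp_eq_Re)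
  have y': "(y has_vector_derivative exp (- (t *\<^sub>R z)) *s g t) (at t)" for t
  proof -
    have "((\<lambda>t. exp (- (t *\<^sub>R z))) has_vector_derivative exp (- (t *\<^sub>R z)) * - z) (at t)"
      using exp_scaleR_has_vector_derivative_right[of "- z" t UNIV] by simp
    from bounded_bilinear.has_vector_derivative[OF bounded_bilinear_complex_smult this x[of t]]
    show ?thesis
      unfolding y_def [abs_def]
      by (rule has_vector_derivative_eq_rhs) (simp add: vec_eq_iff algebra_simps)
  qed
  have bound: "norm (y t - y 0) \<le> K / a * exp (a * t) - K / a" if "0 < t" for t
  proof -
    have "norm (y t - y 0) \<le> K / a * exp (a * t) - K / a * exp (a * 0)"
    proof (rule differentiable_bound_general[OF that])
      show "continuous_on {0..t} y"
        using y' by (auto intro: continuous_at_imp_continuous_on has_vector_derivative_continuous)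
      fix s :: real assume s: "0 < s"
      show "(y has_vector_derivative exp (- (s *\<^sub>R z)) *s g s) (at s)" by (rule y')
      show "((\<lambda>s. K / a * exp (a * s)) has_vector_derivative K * exp (a * s)) (at s)"
        using d(3)
        by (auto simp: has_real_derivative_iff_has_vector_derivative[symmetric]
            intro!: derivative_eq_intros)
      have "norm (exp (- (s *\<^sub>R z)) *s g s) \<le> exp (- (s * Re z)) * (K * exp (- (c * s)))"
        using K[of s] s by (simp add: norm_complex_smult norm_e)
      also have "\<dots> = K * exp (- (s * Re z) - c * s)"
        by (simp add: exp_diff exp_minus field_simps)
      also have "\<dots> \<le> K * exp (a * s)"
        using K0 d s by (auto intro!: mult_left_mono simp: a_def algebra_simps)
      finally show "norm (exp (- (s *\<^sub>R z)) *s g s) \<le> K * exp (a * s)" .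
    qed (use d(3) in \<open>auto intro!: continuous_intros\<close>)
    then show ?thesis by simp
  qed
  have "norm (x t) \<le> (norm (x 0) + K / a) * exp (- (d * t))" if t: "0 \<le> t" for t
  proof -
    have "norm (y t) \<le> norm (x 0) + K / a * exp (a * t)"
    proof (cases "t = 0")
      case True
      then show ?thesis using K0 d(3) by (simp add: y_def)
    next
      case False
      then have "norm (y t - y 0) \<le> K / a * exp (a * t)"
        using bound[of t] t K0 d(3) by (smt (verit) divide_nonneg_pos)
      moreover have "norm (y t) \<le> norm (y 0) + norm (y t - y 0)"
        by (metis add.commute diff_add_cancel norm_triangle_ineq)
      ultimately show ?thesis by (simp add: y_def)
    qed
    also have "norm (y t) = exp (- (t * Re z)) * norm (x t)"
      by (simp add: y_def norm_complex_smult norm_e)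
    finally have "exp (t * Re z) * (exp (- (t * Re z)) * norm (x t))
        \<le> exp (t * Re z) * (norm (x 0) + K / a * exp (a * t))"
      by (intro mult_left_mono) auto
    then have "norm (x t) \<le> exp (t * Re z) * norm (x 0) + K / a * exp (a * t + t * Re z)"
      by (simp add: exp_minus exp_add algebra_simps)
    also have "a * t + t * Re z = - (d * t)"
      by (simp add: a_def algebra_simps)
    also have "exp (t * Re z) * norm (x 0) \<le> exp (- (d * t)) * norm (x 0)"
    proof -
      have "0 \<le> t * a" using d(3) t by simp
      then have "t * Re z \<le> - (d * t)" by (simp add: a_def algebra_simps)
      then show ?thesis by (intro mult_right_mono) auto
    qed
    finally show ?thesis by (simp add: algebra_simps)
  qed
  then show ?thesis
    using d(1) unfolding exp_decaying_def by blast
qed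

section \<open>Annihilating polynomials of single vectors and the complex flow\<close>

lemma complex_matrix_mult: "complex_matrix (X ** Y) = complex_matrix X ** complex_matrix Y"
  by (simp add: vec_eq_iff matrix_matrix_mult_def)

lemma has_vector_derivative_complex_flow:
  "((\<lambda>t. complex_matrix (matrix_exp (t *\<^sub>R A)) *v w) has_vector_derivative
     complex_matrix A *v (complex_matrix (matrix_exp (t *\<^sub>R A)) *v w)) (at t)"
proof -
  have "bounded_linear (\<lambda>M :: real^'a^'a. complex_matrix M *v w)"
    unfolding linear_conv_bounded_linear[symmetric]
    by (rule linearI) (auto simp: vec_eq_iff matrix_vector_mult_def sum.distrib algebra_simps
        scaleR_sum_right, simp add: scaleR_conv_of_real)
  from bounded_linear.has_vector_derivative[OF this has_vector_derivative_matrix_exp]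
  show ?thesis
    by (simp add: complex_matrix_mult matrix_vector_mul_assoc)
qed

text \<open>The list keeps multiplicities, which do the work of Jordan blocks, and lets an induction
  peel off one factor A - z at a time.\<close>

definition root_factors :: "complex ^ 'n ^ 'n \<Rightarrow> complex list \<Rightarrow> complex ^ 'n \<Rightarrow> complex ^ 'n" where
  "root_factors A zs w = foldr (\<lambda>z v. A *v v - z *s v) zs w"

lemma root_factors_simps [simp]:
  "root_factors A [] w = w"
  "root_factors A (z # zs) w = A *v root_factors A zs w - z *s root_factors A zs w"
  by (simp_all add: root_factors_def)

lemma matrix_vector_mult_smult: "A *v (z *s v) = z *s (A *v (v :: complex ^ 'n))"
  by (simp add: vec_eq_iff matrix_vector_mult_def sum_distrib_left mult_ac)

text \<open>Since the factors commute, the factor applied last may be applied first. This is how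
  annihilation of w by \<open>z # zs\<close> becomes annihilation of A w - z w by
  \<open>zs\<close>.\<close>

lemma root_factors_commute:
  "root_factors A zs (A *v w - z *s w) = A *v root_factors A zs w - z *s root_factors A zs w"
  by (induction zs)
    (simp_all add: matrix_vector_mult_diff_distrib matrix_vector_mult_smult vector_ssub_ldistrib
      vector_smult_assoc mult.commute)

text \<open>A factor \<open>A - z\<close> with \<open>0 \<le> Re z\<close> is injective and can be dropped; for the other factors the flow of
  \<open>w\<close> solves \<open>x' = z x + g\<close>, where \<open>g\<close> is the flow of a vector annihilated by fewer factors.\<close>

lemma exp_decaying_flow_if_annihilated:
  fixes A :: "real ^ 'n ^ 'n"
  assumes "hurwitz A" and "root_factors (complex_matrix A) zs w = 0"
  shows "exp_decaying (\<lambda>t. complex_matrix (matrix_exp (t *\<^sub>R A)) *v w)"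
  using assms(2)
proof (induction zs arbitrary: w)
  case Nil
  then show ?case
    by (auto simp: exp_decaying_def intro!: exI[of _ 1])
next
  case (Cons z zs)
  show ?case
  proof (cases "Re z < 0")
    case True
    let ?A = "complex_matrix A" and ?E = "\<lambda>t. complex_matrix (matrix_exp (t *\<^sub>R A))"
    define w' where "w' = ?A *v w - z *s w"
    have "exp_decaying (\<lambda>t. ?E t *v w')"
      using Cons by (simp add: w'_def root_factors_commute)
    moreover have "?A *v (?E t *v w) = z *s (?E t *v w) + ?E t *v w'" for t
    proof -
      have "?A *v (?E t *v w) = ?E t *v (?A *v w)"
        by (simp add: matrix_vector_mul_assoc matrix_exp_commute flip: complex_matrix_mult)
      then show ?thesis
        by (simp add: w'_def matrix_vector_mult_diff_distrib matrix_vector_mult_smult)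
    qed
    ultimately show ?thesis
      using exp_decaying_forced[OF _ True, of "\<lambda>t. ?E t *v w" "\<lambda>t. ?E t *v w'"]
        has_vector_derivative_complex_flow[of A w] by simp
  next
    case False
    then have "root_factors (complex_matrix A) zs w = 0"
      using Cons.prems assms(1) unfolding hurwitz_def by fastforce
    then show ?thesis by (rule Cons.IH)
  qed
qed

definition poly_apply :: "complex ^ 'n ^ 'n \<Rightarrow> complex poly \<Rightarrow> complex ^ 'n \<Rightarrow> complex ^ 'n" where
  "poly_apply A p w = (\<Sum>i\<le>degree p. coeff p i *s ((*v) A ^^ i) w)"

lemma poly_apply_altdef:
  "degree p \<le> N \<Longrightarrow> poly_apply A p w = (\<Sum>i\<le>N. coeff p i *s ((*v) A ^^ i) w)"
  unfolding poly_apply_def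
  by (intro sum.mono_neutral_left) (auto simp: coeff_eq_0)

lemma poly_apply_factor:
  "poly_apply A ([:- z, 1:] * p) w = A *v poly_apply A p w - z *s poly_apply A p w"
proof -
  let ?N = "degree p"
  have deg: "degree ([:- z, 1:] * p) \<le> Suc ?N"
    using degree_mult_le[of "[:- z, 1:]" p] by simp
  \<comment> \<open>\<open>pCons 0 p\<close> is X times p: its constant coefficient is 0, so its sum
    can be reindexed by one, which pulls out one application of A.\<close>
  have "poly_apply A ([:- z, 1:] * p) w
      = (\<Sum>i\<le>Suc ?N. coeff (pCons 0 p) i *s ((*v) A ^^ i) w - z *s (coeff p i *s ((*v) A ^^ i) w))"
    unfolding poly_apply_altdef[OF deg]
    by (intro sum.cong) (simp_all add: vec_eq_iff algebra_simps)
  also have "\<dots> = (\<Sum>i\<le>?N. coeff p i *s (A *v ((*v) A ^^ i) w))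
      - z *s (\<Sum>i\<le>Suc ?N. coeff p i *s ((*v) A ^^ i) w)"
    by (simp only: sum_subtractf sum.atMost_Suc_shift)
      (simp add: vec_eq_iff sum_distrib_left mult.assoc)
  also have "(\<Sum>i\<le>Suc ?N. coeff p i *s ((*v) A ^^ i) w) = poly_apply A p w"
    by (rule poly_apply_altdef[symmetric]) simp
  also have "(\<Sum>i\<le>?N. coeff p i *s (A *v ((*v) A ^^ i) w)) = A *v poly_apply A p w"
    unfolding poly_apply_def
    by (simp add: matrix_vector_mult_smult vec.linear_sum[OF matrix_vector_mul_linear_gen])
  finally show ?thesis .
qed

lemma poly_apply_smult_prod_list:
  "poly_apply A (smult c (\<Prod>z\<leftarrow>zs. [:- z, 1:])) w = c *s root_factors A zs w"
proof (induction zs)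
  case Nil
  then show ?case by (simp add: poly_apply_altdef[of _ 0])
next
  case (Cons z zs)
  have "poly_apply A (smult c (\<Prod>z\<leftarrow>z # zs. [:- z, 1:])) w
      = poly_apply A ([:- z, 1:] * smult c (\<Prod>z\<leftarrow>zs. [:- z, 1:])) w"
    by (simp only: list.map prod_list.Cons mult_smult_right)
  also have "\<dots> = c *s root_factors A (z # zs) w"
    unfolding poly_apply_factor Cons.IH
    by (simp add: vector_ssub_ldistrib matrix_vector_mult_smult vector_smult_assoc mult.commute)
  finally show ?case .
qed

text \<open>One vector more than the dimension forces a relation. \<open>dependent\<close> concerns
  sets, so a family with a repeated vector is treated separately, by the difference of two equal
  members.\<close>

lemma nontrivial_relation:
  fixes f :: "nat \<Rightarrow> 'a::euclidean_space"
  obtains c :: "nat \<Rightarrow> real" where "\<exists>i\<le>DIM('a). c i \<noteq> 0" "(\<Sum>i\<le>DIM('a). c i *\<^sub>R f i) = 0"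
proof (cases "inj_on f {..DIM('a)}")
  case True
  let ?S = "f ` {..DIM('a)}"
  have "dependent ?S"
    using True by (intro dependent_biggerset) (simp add: card_image)
  then obtain u v where uv: "v \<in> ?S" "u v \<noteq> 0" "(\<Sum>v\<in>?S. u v *\<^sub>R v) = 0"
    using dependent_finite[of ?S] by auto
  then show ?thesis
    using True that[of "u \<circ> f"] by (auto simp: sum.reindex)
next
  case False
  then obtain i j where ij: "i \<le> DIM('a)" "j \<le> DIM('a)" "i \<noteq> j" "f i = f j"
    by (auto simp: inj_on_def)
  define c :: "nat \<Rightarrow> real" where "c k = of_bool (k = i) - of_bool (k = j)" for k
  have "(\<Sum>k\<le>DIM('a). c k *\<^sub>R f k) = 0"
    using ij by (simp add: c_def scaleR_diff_left sum_subtractf of_bool_def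
        if_distrib[of "\<lambda>x. x *\<^sub>R _"] cong: if_cong)
  then show ?thesis
    using ij by (intro that[of c]) (auto simp: c_def intro!: exI[of _ i])
qed

text \<open>Among the iterates of A on w there is a relation, with real coefficients because
  \<open>DIM\<close> is the real dimension. Read as a polynomial it splits over the complex numbers.
  The resulting list depends on w, which suffices as decay is tested on one unit vector at a
  time.\<close>

lemma exists_annihilating_root_factors: "\<exists>zs. root_factors A zs w = 0"
proof -
  obtain c where c: "\<exists>i\<le>DIM(complex^'a). c i \<noteq> 0"
      "(\<Sum>i\<le>DIM(complex^'a). c i *\<^sub>R ((*v) A ^^ i) w) = 0"
    using nontrivial_relation[of "\<lambda>i. ((*v) A ^^ i) w"] by blast
  define p where "p = (\<Sum>i\<le>DIM(complex^'a). monom (complex_of_real (c i)) i)"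
  have coeff: "coeff p i = (if i \<le> DIM(complex^'a) then of_real (c i) else 0)" for i
    by (auto simp: p_def coeff_sum)
  have p0: "p \<noteq> 0"
    using c(1) coeff by (metis coeff_0 of_real_eq_0_iff)
  have "degree p \<le> DIM(complex^'a)"
    by (intro degree_le) (auto simp: coeff)
  from poly_apply_altdef[OF this, of A w]
  have "poly_apply A p w = (\<Sum>i\<le>DIM(complex^'a). c i *\<^sub>R ((*v) A ^^ i) w)"
    by (elim trans, intro sum.cong) (auto simp: coeff vec_eq_iff scaleR_conv_of_real[where 'a=complex])
  then have "poly_apply A p w = 0"
    using c(2) by simp
  moreover obtain zs where zs: "p = smult (lead_coeff p) (\<Prod>z\<leftarrow>zs. [:- z, 1:])"
    using alg_closed_imp_factorization[OF p0] by (metis ex_mset mset_map prod_mset_prod_list)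
  then have "poly_apply A p w = lead_coeff p *s root_factors A zs w"
    by (metis poly_apply_smult_prod_list)
  ultimately have "lead_coeff p *s root_factors A zs w = 0"
    by simp
  then show ?thesis
    using p0 by auto
qed

lemma exp_decaying_tendsto_0:
  assumes "exp_decaying f" shows "(f \<longlongrightarrow> 0) at_top"
proof -
  obtain K c where c: "0 < c" and K: "\<And>t. 0 \<le> t \<Longrightarrow> norm (f t) \<le> K * exp (- (c * t))"
    using assms unfolding exp_decaying_def by blast
  have "((\<lambda>t. K * exp (- (c * t))) \<longlongrightarrow> K * 0) at_top"
    using c by (intro tendsto_mult tendsto_const filterlim_compose[OF exp_at_bot])
      (auto simp: filterlim_uminus_at_bot intro!: filterlim_tendsto_pos_mult_at_top[OF tendsto_const] filterlim_ident)
  then show ?thesis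
    by (intro Lim_null_comparison[of f]) (use K in \<open>auto simp: eventually_at_top_linorder intro!: exI[of _ 0]\<close>)
qed

lemma hurwitz_matrix_exp_tendsto_0:
  assumes "hurwitz A" shows "((\<lambda>t. matrix_exp (t *\<^sub>R A)) \<longlongrightarrow> 0) at_top"
proof (intro vec_tendstoI)
  fix i j
  \<comment> \<open>The flow of a unit vector is a column of the matrix exponential.\<close>
  let ?f = "\<lambda>t. complex_matrix (matrix_exp (t *\<^sub>R A)) *v axis j 1"
  obtain zs where "root_factors (complex_matrix A) zs (axis j 1) = 0"
    using exists_annihilating_root_factors by blast
  then have "(?f \<longlongrightarrow> 0) at_top"
    using exp_decaying_tendsto_0 exp_decaying_flow_if_annihilated assms by blast
  then have "((\<lambda>t. Re (?f t $ i)) \<longlongrightarrow> Re ((0 :: complex^'a) $ i)) at_top"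
    by (intro tendsto_intros)
  then show "((\<lambda>t. matrix_exp (t *\<^sub>R A) $ i $ j) \<longlongrightarrow> 0 $ i $ j) at_top"
    by (simp add: matrix_vector_mult_def axis_def if_distrib cong: if_cong)
qed

section \<open>The periodic impulse response and the DC gain\<close>

lemma
  assumes "invertible P"
  shows matrix_inv_right: "P ** matrix_inv P = mat 1" and matrix_inv_left: "matrix_inv P ** P = mat 1"
  using someI_ex[OF assms[unfolded invertible_def]] by (simp_all add: matrix_inv_def)

lemma matrix_inv_unique:
  fixes P :: "'a::comm_ring_1 ^ 'n ^ 'n"
  assumes "P ** Q = mat 1" "Q ** P = mat 1"
  shows "matrix_inv P = Q"
proof -
  have "invertible P" using assms by (auto simp: invertible_def)
  then have "matrix_inv P ** (P ** Q) = Q"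
    by (simp only: matrix_mul_assoc matrix_inv_left matrix_mul_lid)
  then show ?thesis by (simp add: assms)
qed

lemma hurwitz_matrix_pow_exp_tendsto_0:
  assumes "hurwitz A" "0 < T"
  shows "(\<lambda>k. matrix_pow (matrix_exp (T *\<^sub>R A)) k) \<longlonglongrightarrow> 0"
proof -
  have "filterlim (\<lambda>k. real k * T) at_top sequentially"
    using assms(2) by (intro filterlim_at_top_mult_tendsto_pos[OF tendsto_const] filterlim_real_sequentially)
  from filterlim_compose[OF hurwitz_matrix_exp_tendsto_0[OF assms(1)] this]
  show ?thesis by (simp add: matrix_exp_of_nat_mult)
qed

text \<open>A kernel vector would be fixed by the flow over one period, hence by all its powers,
  which tend to 0.\<close>

lemma hurwitz_invertible_one_minus_exp:
  fixes A :: "real ^ 'n ^ 'n"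
  assumes "hurwitz A" "0 < T"
  shows "invertible (mat 1 - matrix_exp (T *\<^sub>R A))"
  unfolding invertible_left_inverse matrix_left_invertible_ker
proof (intro allI impI)
  fix v :: "real ^ 'n"
  let ?M = "matrix_exp (T *\<^sub>R A)"
  assume "(mat 1 - ?M) *v v = 0"
  then have "?M *v v = v" by (simp add: mv.diff_left)
  then have "matrix_pow ?M k *v v = v" for k
    by (induction k) (simp_all add: matrix_vector_mul_assoc[symmetric])
  then have "(\<lambda>k. v) \<longlonglongrightarrow> 0 *v v"
    using mv.tendsto[OF hurwitz_matrix_pow_exp_tendsto_0[OF assms] tendsto_const[of v]] by simp
  then show "v = 0"
    by (simp add: LIMSEQ_const_iff)
qed

text \<open>Multiplied by the inverse of 1 - M, the powers of M telescope to the terms of the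
  geometric series. Only the convergence of the powers to 0 enters, no norm below 1.\<close>

lemma hurwitz_sums_exp:
  assumes "hurwitz A" "0 < T"
  shows "(\<lambda>k. matrix_exp ((real k * T) *\<^sub>R A)) sums matrix_inv (mat 1 - matrix_exp (T *\<^sub>R A))"
proof -
  let ?M = "matrix_exp (T *\<^sub>R A)" and ?R = "matrix_inv (mat 1 - matrix_exp (T *\<^sub>R A))"
  have R: "(mat 1 - ?M) ** ?R = mat 1"
    using matrix_inv_right hurwitz_invertible_one_minus_exp[OF assms] by blast
  have "(\<lambda>k. matrix_pow ?M k ** ?R) \<longlonglongrightarrow> 0 ** ?R"
    by (intro mm.tendsto hurwitz_matrix_pow_exp_tendsto_0 assms tendsto_const)
  from telescope_sums'[OF this]
  have "(\<lambda>k. matrix_pow ?M k ** ?R - matrix_pow ?M (Suc k) ** ?R) sums ?R"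
    by simp
  moreover have "matrix_pow ?M k ** ?R - matrix_pow ?M (Suc k) ** ?R = matrix_pow ?M k" for k
  proof -
    have "matrix_pow ?M k ** ?R - matrix_pow ?M (Suc k) ** ?R
        = matrix_pow ?M k ** ((mat 1 - ?M) ** ?R)"
      by (simp add: mm.diff_left mm.diff_right matrix_mul_assoc matrix_pow_commute)
    then show ?thesis by (simp add: R)
  qed
  ultimately show ?thesis
    by (simp add: matrix_exp_of_nat_mult)
qed

lemma hurwitz_periodic_impulse_sums:
  assumes "hurwitz A" "0 < T"
  shows "(\<lambda>k. C ** matrix_exp ((t + real k * T) *\<^sub>R A) ** B) sums
    (C ** matrix_exp (t *\<^sub>R A) ** matrix_inv (mat 1 - matrix_exp (T *\<^sub>R A)) ** B)"
proof -
  have "bounded_linear (\<lambda>X. C ** matrix_exp (t *\<^sub>R A) ** X ** B)"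
    by (intro bounded_linear_compose[OF mm.bounded_linear_left] mm.bounded_linear_right)
  from bounded_linear.sums[OF this hurwitz_sums_exp[OF assms]]
  show ?thesis
    by (simp add: matrix_exp_add matrix_mul_assoc)
qed

lemma periodic_impulse_response_eq:
  assumes "hurwitz A" "0 < T"
  shows "periodic_impulse_response A B C T t =
    C ** matrix_exp (t *\<^sub>R A) ** matrix_inv (mat 1 - matrix_exp (T *\<^sub>R A)) ** B"
  unfolding periodic_impulse_response_def
  using hurwitz_periodic_impulse_sums[OF assms, where C=C and t=t and B=B] by (simp add: sums_iff)

lemma matrix_inv_commute:
  assumes "invertible P" "P ** X = X ** P"
  shows "matrix_inv P ** X = X ** matrix_inv P"
proof -
  have "matrix_inv P ** X = matrix_inv P ** (X ** P) ** matrix_inv P"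
    by (simp add: matrix_mul_assoc[symmetric] matrix_inv_right assms(1))
  also have "\<dots> = X ** matrix_inv P"
    by (simp add: assms(2)[symmetric] matrix_mul_assoc matrix_inv_left assms(1))
  finally show ?thesis .
qed

lemma matrix_inv_exp_commute:
  assumes "hurwitz A" "0 < T"
  shows "matrix_exp (t *\<^sub>R A) ** matrix_inv (mat 1 - matrix_exp (T *\<^sub>R A))
    = matrix_inv (mat 1 - matrix_exp (T *\<^sub>R A)) ** matrix_exp (t *\<^sub>R A)"
  by (rule matrix_inv_commute[symmetric, OF hurwitz_invertible_one_minus_exp[OF assms]])
    (simp add: mm.diff_left mm.diff_right add.commute flip: matrix_exp_add)

section \<open>The static gain and its norm\<close>

lemma hurwitz_invertible:
  fixes A :: "real ^ 'n ^ 'n"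
  assumes "hurwitz A" shows "invertible A"
  unfolding invertible_left_inverse matrix_left_invertible_ker
proof (intro allI impI, rule ccontr)
  fix v :: "real ^ 'n"
  assume v: "A *v v = 0" "v \<noteq> 0"
  \<comment> \<open>The kernel vector, read as a complex vector, is an eigenvector for the
    eigenvalue 0, whose real part is not negative.\<close>
  define w :: "complex ^ 'n" where "w = (\<chi> i. of_real (v $ i))"
  have "complex_matrix A *v w = (\<chi> i. of_real ((A *v v) $ i))"
    by (simp add: vec_eq_iff matrix_vector_mult_def w_def)
  then have "complex_matrix A *v w = 0 *s w"
    using v(1) by (simp add: vec_eq_iff)
  moreover have "w \<noteq> 0"
    using v(2) by (auto simp: w_def vec_eq_iff)
  ultimately have "Re 0 < 0"
    using assms unfolding hurwitz_def by blast
  then show False by simp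
qed

text \<open>G(0) as a real matrix, so that it can act on the real mean of the input;
  \<open>transfer_matrix\<close> is complex.\<close>

definition dc_gain :: "real ^ 'n ^ 'n \<Rightarrow> real ^ 'm ^ 'n \<Rightarrow> real ^ 'n ^ 'p \<Rightarrow> real ^ 'm ^ 'p" where
  "dc_gain A B C = - (C ** matrix_inv A ** B)"

lemma transfer_matrix_0:
  fixes A :: "real ^ 'n ^ 'n"
  assumes "hurwitz A"
  shows "transfer_matrix A B C 0 = complex_matrix (dc_gain A B C)"
proof -
  let ?A = "complex_matrix A" and ?I = "complex_matrix (- matrix_inv A)"
  have inv: "A ** matrix_inv A = mat 1" "matrix_inv A ** A = mat 1"
    using hurwitz_invertible[OF assms] matrix_inv_right matrix_inv_left by blast+
  have 1: "complex_matrix (mat 1 :: real^'n^'n) = mat 1"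
    by (simp add: vec_eq_iff mat_def)
  have neg: "mat 0 - ?A = complex_matrix (- A)"
    by (simp add: vec_eq_iff mat_def)
  have "matrix_inv (mat 0 - ?A) = ?I"
    unfolding neg
    by (rule matrix_inv_unique)
      (simp_all add: 1 inv mm.minus_left mm.minus_right flip: complex_matrix_mult)
  then show ?thesis
    by (simp add: transfer_matrix_def dc_gain_def mm.minus_left mm.minus_right flip: complex_matrix_mult)
qed

lemma norm_complex_vec:
  "norm (z :: complex ^ 'n) = sqrt ((norm (\<chi> i. Re (z $ i)))\<^sup>2 + (norm (\<chi> i. Im (z $ i)))\<^sup>2)"
  by (simp add: norm_vec_def L2_set_def cmod_power2 sum.distrib sum_nonneg)

text \<open>Real and imaginary parts are mapped independently by a real matrix, so complex vectors do
  not increase its norm.\<close>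

lemma onorm_complex_matrix:
  fixes M :: "real ^ 'm ^ 'p"
  shows "onorm ((*v) (complex_matrix M)) = onorm ((*v) M)"
proof (rule antisym)
  have bl: "bounded_linear ((*v) M)" by (rule mv.bounded_linear_right)
  have blc: "bounded_linear ((*v) (complex_matrix M))"
    unfolding linear_conv_bounded_linear[symmetric]
    by (rule linearI) (auto simp: vec_eq_iff matrix_vector_mult_def sum.distrib algebra_simps
        scaleR_sum_right)
  show "onorm ((*v) (complex_matrix M)) \<le> onorm ((*v) M)"
  proof (rule onorm_bound[OF onorm_pos_le[OF bl]])
    fix z :: "complex ^ 'm"
    let ?x = "\<chi> i. Re (z $ i)" and ?y = "\<chi> i. Im (z $ i)"
    have parts: "(\<chi> i. Re ((complex_matrix M *v z) $ i)) = M *v ?x"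
      "(\<chi> i. Im ((complex_matrix M *v z) $ i)) = M *v ?y"
      by (simp_all add: vec_eq_iff matrix_vector_mult_def)
    have le: "(norm (M *v x))\<^sup>2 \<le> (onorm ((*v) M))\<^sup>2 * (norm x)\<^sup>2" for x
      using power_mono[OF onorm[OF bl, of x], of 2] by (simp add: power_mult_distrib)
    have "norm (complex_matrix M *v z) = sqrt ((norm (M *v ?x))\<^sup>2 + (norm (M *v ?y))\<^sup>2)"
      by (subst norm_complex_vec) (simp only: parts)
    also have "\<dots> \<le> sqrt ((onorm ((*v) M))\<^sup>2 * ((norm ?x)\<^sup>2 + (norm ?y)\<^sup>2))"
      using le[of ?x] le[of ?y] by (intro real_sqrt_le_mono) (simp add: distrib_left)
    also have "\<dots> = onorm ((*v) M) * norm z"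
      by (subst norm_complex_vec) (simp add: real_sqrt_mult onorm_pos_le[OF bl])
    finally show "norm (complex_matrix M *v z) \<le> onorm ((*v) M) * norm z" .
  qed
  show "onorm ((*v) M) \<le> onorm ((*v) (complex_matrix M))"
  proof (rule onorm_bound[OF onorm_pos_le[OF blc]])
    fix x :: "real ^ 'm"
    have c: "norm ((\<chi> i. complex_of_real (y $ i)) :: complex ^ 'k) = norm y" for y :: "real ^ 'k"
      by (simp add: norm_vec_def L2_set_def)
    have "complex_matrix M *v (\<chi> i. of_real (x $ i)) = (\<chi> i. of_real ((M *v x) $ i))"
      by (simp add: vec_eq_iff matrix_vector_mult_def)
    then show "norm (M *v x) \<le> onorm ((*v) (complex_matrix M)) * norm x"
      using onorm[OF blc, of "\<chi> i. of_real (x $ i)"] by (simp add: c)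
  qed
qed

lemma gamma_dc_eq:
  assumes "hurwitz A" shows "gamma_dc A B C = onorm ((*v) (dc_gain A B C))"
  by (simp add: gamma_dc_def transfer_matrix_0[OF assms] onorm_complex_matrix)

section \<open>Caratheodory solutions\<close>

text \<open>A local form of \<open>essbounded\<close> that also covers continuous functions on
  compact intervals. The exceptional set is taken in \<open>lebesgue\<close>, with membership in S
  as a premise, so that S can be shrunk without changing the measure.\<close>

definition ae_bounded :: "real set \<Rightarrow> (real \<Rightarrow> 'a::euclidean_space) \<Rightarrow> bool" where
  "ae_bounded S f \<longleftrightarrow> f \<in> borel_measurable (lebesgue_on S) \<and>
     (\<exists>K. AE x in lebesgue. x \<in> S \<longrightarrow> norm (f x) \<le> K)"

lemma ae_boundedE:
  assumes "ae_bounded S f"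
  obtains K where "0 \<le> K" "AE x in lebesgue. x \<in> S \<longrightarrow> norm (f x) \<le> K"
proof -
  obtain K where "AE x in lebesgue. x \<in> S \<longrightarrow> norm (f x) \<le> K"
    using assms by (auto simp: ae_bounded_def)
  then have "AE x in lebesgue. x \<in> S \<longrightarrow> norm (f x) \<le> max 0 K"
    by eventually_elim auto
  then show ?thesis by (intro that[of "max 0 K"]) auto
qed

lemma ae_bounded_subset:
  assumes "ae_bounded S f" "R \<subseteq> S" shows "ae_bounded R f"
proof -
  obtain K where "AE x in lebesgue. x \<in> S \<longrightarrow> norm (f x) \<le> K"
    using assms by (auto simp: ae_bounded_def)
  then have "AE x in lebesgue. x \<in> R \<longrightarrow> norm (f x) \<le> K"
    by eventually_elim (use assms(2) in auto)
  moreover have "f \<in> borel_measurable (lebesgue_on R)"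
    using assms measurable_restrict_mono by (auto simp: ae_bounded_def)
  ultimately show ?thesis by (auto simp: ae_bounded_def)
qed

lemma ae_bounded_absolutely_integrable:
  assumes "ae_bounded {a..b} f" shows "f absolutely_integrable_on {a..b}"
proof -
  obtain K where K: "AE x in lebesgue. x \<in> {a..b} \<longrightarrow> norm (f x) \<le> K"
    and f: "f \<in> borel_measurable (lebesgue_on {a..b})"
    using assms by (auto simp: ae_bounded_def)
  interpret finite_measure "lebesgue_on {a..b}"
    by (rule finite_measure_lebesgue_on) auto
  have "integrable (lebesgue_on {a..b}) f"
    using K f by (intro integrable_const_bound[where B=K]) (auto simp: AE_restrict_space_iff)
  then show ?thesis
    by (simp add: set_integrable_def integrable_restrict_space)
qed

lemma ae_bounded_integrable: "ae_bounded {a..b} f \<Longrightarrow> f integrable_on {a..b}"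
  using ae_bounded_absolutely_integrable set_lebesgue_integral_eq_integral(1) by blast

text \<open>The integral bound asks for a pointwise estimate, so f is set to zero on the exceptional
  null set, which leaves the integral unchanged.\<close>

lemma norm_integral_le_if_AE:
  fixes f :: "real \<Rightarrow> 'a::euclidean_space"
  assumes f: "f integrable_on {a..b}" and "a \<le> b" "0 \<le> K"
    and "AE x in lebesgue. x \<in> {a..b} \<longrightarrow> norm (f x) \<le> K"
  shows "norm (integral {a..b} f) \<le> K * (b - a)"
proof -
  obtain N where N: "{x. \<not> (x \<in> {a..b} \<longrightarrow> norm (f x) \<le> K)} \<subseteq> N" "negligible N"
    using assms(4) unfolding eventually_ae_filter negligible_iff_null_sets by auto
  define h where "h x = (if x \<in> N then 0 else f x)" for x
  have h: "(h has_integral integral {a..b} f) {a..b}"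
    by (rule has_integral_spike[OF N(2) _ integrable_integral[OF f]]) (simp add: h_def)
  have "norm (integral {a..b} f) \<le> K * measure lborel {a..b}"
    by (rule has_integral_bound_real[OF assms(3) finite.emptyI h]) (use N assms(3) in \<open>auto simp: h_def\<close>)
  then show ?thesis using assms(2) by simp
qed

lemma bounded_continuous_image:
  fixes f :: "real \<Rightarrow> 'a::real_normed_vector"
  assumes "continuous_on {a..b} f"
  obtains M where "0 \<le> M" "\<And>x. x \<in> {a..b} \<Longrightarrow> norm (f x) \<le> M"
proof -
  have "bounded (f ` {a..b})"
    by (intro compact_imp_bounded compact_continuous_image assms) auto
  then obtain M where "0 < M" "\<forall>y\<in>f ` {a..b}. norm y \<le> M"
    unfolding bounded_pos by blast
  then show ?thesis
    by (intro that[of M]) auto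
qed

lemma ae_bounded_continuous: "continuous_on {a..b} f \<Longrightarrow> ae_bounded {a..b} f"
  unfolding ae_bounded_def
proof (intro conjI)
  assume c: "continuous_on {a..b} f"
  obtain M where "\<And>x. x \<in> {a..b} \<Longrightarrow> norm (f x) \<le> M"
    using bounded_continuous_image[OF c] by blast
  then show "\<exists>K. AE x in lebesgue. x \<in> {a..b} \<longrightarrow> norm (f x) \<le> K"
    by (intro exI[of _ M] AE_I2) blast
  show "f \<in> borel_measurable (lebesgue_on {a..b})"
    by (intro continuous_imp_measurable_on_sets_lebesgue c) auto
qed

lemma ae_bounded_add:
  assumes "ae_bounded S f" "ae_bounded S g" shows "ae_bounded S (\<lambda>x. f x + g x)"
proof -
  obtain K L where "AE x in lebesgue. x \<in> S \<longrightarrow> norm (f x) \<le> K"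
    "AE x in lebesgue. x \<in> S \<longrightarrow> norm (g x) \<le> L"
    using assms by (auto simp: ae_bounded_def)
  then have "AE x in lebesgue. x \<in> S \<longrightarrow> norm (f x + g x) \<le> K + L"
    by eventually_elim (auto intro: norm_triangle_mono)
  then show ?thesis using assms by (auto simp: ae_bounded_def)
qed

lemma ae_bounded_matrix_vector_mult:
  fixes E :: "real \<Rightarrow> real ^ 'n ^ 'm"
  assumes "continuous_on {a..b} E" "ae_bounded {a..b} f"
  shows "ae_bounded {a..b} (\<lambda>x. E x *v f x)"
proof -
  obtain K where K: "0 \<le> K" "AE x in lebesgue. x \<in> {a..b} \<longrightarrow> norm (f x) \<le> K"
    using ae_boundedE[OF assms(2)] .
  obtain M where M: "\<And>x. x \<in> {a..b} \<Longrightarrow> norm (E x) \<le> M"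
    using bounded_continuous_image[OF assms(1)] by blast
  obtain L where L: "0 < L" "\<And>(X::real^'n^'m) v. norm (X *v v) \<le> norm X * norm v * L"
    using mv.pos_bounded by blast
  have "AE x in lebesgue. x \<in> {a..b} \<longrightarrow> norm (E x *v f x) \<le> M * K * L"
    using K(2)
  proof eventually_elim
    case (elim x)
    show ?case
    proof
      assume x: "x \<in> {a..b}"
      have "norm (E x) * norm (f x) * L \<le> M * K * L"
        using elim x M[OF x] L(1) by (intro mult_right_mono mult_mono) (auto intro: order_trans[OF norm_ge_zero])
      then show "norm (E x *v f x) \<le> M * K * L"
        using L(2) order_trans by blast
    qed
  qed
  moreover have "(\<lambda>x. E x *v f x) \<in> borel_measurable (lebesgue_on {a..b})"
  proof (rule borel_measurable_continuous_Pair[where H="(*v)"])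
    show "E \<in> borel_measurable (lebesgue_on {a..b})"
      by (intro continuous_imp_measurable_on_sets_lebesgue assms) auto
    show "f \<in> borel_measurable (lebesgue_on {a..b})"
      using assms by (simp add: ae_bounded_def)
    show "continuous_on UNIV (\<lambda>x. (fst x :: real^'n^'m) *v snd x)"
      by (intro mv.continuous_on continuous_intros)
  qed
  ultimately show ?thesis by (auto simp: ae_bounded_def)
qed

lemma essbounded_ae_bounded:
  assumes "essbounded f" shows "ae_bounded S f"
proof -
  have f: "f \<in> borel_measurable lebesgue"
    and fin: "esssup lebesgue (\<lambda>t. ereal (norm (f t))) < \<infinity>"
    using assms by (auto simp: essbounded_def)
  obtain K :: nat where K: "esssup lebesgue (\<lambda>t. ereal (norm (f t))) < ereal K"
    using fin by (auto simp: less_PInf_Ex_of_nat)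
  have "AE x in lebesgue. ereal (norm (f x)) \<le> esssup lebesgue (\<lambda>t. ereal (norm (f t)))"
    by (rule esssup_AE)
  then have "AE x in lebesgue. x \<in> S \<longrightarrow> norm (f x) \<le> K"
    by eventually_elim (use K in \<open>auto dest: order.strict_trans1\<close>)
  then show ?thesis
    using f measurable_restrict_space1 by (auto simp: ae_bounded_def)
qed

text \<open>Difference quotients are of first order in the step, so F has derivative zero throughout
  the interval.\<close>

lemma eq_if_quadratic_increments:
  fixes F :: "real \<Rightarrow> 'a::real_normed_vector"
  assumes "a \<le> b" and F: "\<And>s t. a \<le> s \<Longrightarrow> s \<le> t \<Longrightarrow> t \<le> b \<Longrightarrow> norm (F t - F s) \<le> c * (t - s)\<^sup>2"
  shows "F a = F b"
proof -
  have "(F has_derivative (\<lambda>h. 0)) (at x within {a..b})" if x: "x \<in> {a..b}" for x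
  proof (rule has_derivativeI_sandwich[of 1 _ _ _ _ "\<lambda>y. c * \<bar>y - x\<bar>"])
    fix y assume y: "y \<in> {a..b}" "y \<noteq> x"
    have "norm (F y - F x) \<le> c * (y - x)\<^sup>2"
      using F[of x y] F[of y x] x y by (cases "x \<le> y") (auto simp: norm_minus_commute power2_commute)
    also have "(y - x)\<^sup>2 = \<bar>y - x\<bar> * \<bar>y - x\<bar>"
      by (simp add: power2_eq_square)
    finally show "norm (F y - F x - 0) / norm (y - x) \<le> c * \<bar>y - x\<bar>"
      using y by (simp add: field_simps)
  next
    show "((\<lambda>y. c * \<bar>y - x\<bar>) \<longlongrightarrow> 0) (at x within {a..b})"
      by (auto intro!: tendsto_eq_intros)
  qed auto
  then obtain k where "\<And>x. x \<in> {a..b} \<Longrightarrow> F x = k"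
    using has_derivative_zero_constant[of "{a..b}" F] by auto
  then show ?thesis using assms(1) by simp
qed

lemma integral_diff_real:
  fixes f :: "real \<Rightarrow> 'a::euclidean_space"
  assumes "f integrable_on {a..b}" "a \<le> s" "s \<le> t" "t \<le> b"
  shows "integral {a..t} f - integral {a..s} f = integral {s..t} f"
  using Henstock_Kurzweil_Integration.integral_combine[of a s t f]
    integrable_subinterval_real[OF assms(1), of a t] assms
  by (auto simp: algebra_simps)

text \<open>Since \<open>G\<close> is merely Lipschitz, the usual proof by differentiating \<open>E * G\<close> is not available;
  instead the difference of both sides has increments of second order, hence is constant.\<close>

lemma integration_by_parts_matrix_vector:
  fixes E :: "real \<Rightarrow> real ^ 'n ^ 'm" and g G :: "real \<Rightarrow> real ^ 'n"
  assumes ab: "a \<le> b"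
    and E: "\<And>t. (E has_vector_derivative E' t) (at t)"
    and E': "continuous_on UNIV E'"
    and g: "ae_bounded {a..b} g"
    and G: "\<And>t. t \<in> {a..b} \<Longrightarrow> G t = G a + integral {a..t} g"
  shows "integral {a..b} (\<lambda>s. E s *v g s) =
    E b *v G b - E a *v G a - integral {a..b} (\<lambda>s. E' s *v G s)"
proof -
  have cE: "continuous_on S E" for S
    using E by (auto intro: continuous_at_imp_continuous_on has_vector_derivative_continuous)
  have cE': "continuous_on S E'" for S
    using E' continuous_on_subset by blast
  have gint: "g integrable_on {s..t}" if "a \<le> s" "t \<le> b" for s t
    using ae_bounded_integrable[OF ae_bounded_subset[OF g]] that by auto
  have "continuous_on {a..b} (\<lambda>t. G a + integral {a..t} g)"
    by (intro continuous_on_add continuous_on_const indefinite_integral_continuous_1 gint) auto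
  then have cG: "continuous_on {a..b} G"
    by (rule continuous_on_eq) (rule G[symmetric])
  obtain K where K: "0 \<le> K" "AE x in lebesgue. x \<in> {a..b} \<longrightarrow> norm (g x) \<le> K"
    using ae_boundedE[OF g] .
  obtain M where M: "0 \<le> M" "\<And>x. x \<in> {a..b} \<Longrightarrow> norm (E' x) \<le> M"
    using bounded_continuous_image[OF cE'] by metis
  obtain L where L: "0 < L" "\<And>(X::real^'n^'m) v. norm (X *v v) \<le> norm X * norm v * L"
    using mv.pos_bounded by blast
  have dE: "(E' has_integral (E t - E s)) {s..t}" if "s \<le> t" for s t
    using that E by (intro fundamental_theorem_of_calculus) (auto intro: has_vector_derivative_at_within)
  have dG: "G t - G s = integral {s..t} g" if "a \<le> s" "s \<le> t" "t \<le> b" for s t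
  proof -
    have "G s = G a + integral {a..s} g" "G t = G a + integral {a..t} g"
      using that by (auto intro!: G)
    moreover have "integral {a..t} g - integral {a..s} g = integral {s..t} g"
      by (rule integral_diff_real[OF gint, of a b]) (use that in auto)
    ultimately show ?thesis by (metis add_diff_cancel_left)
  qed
  have Eg: "(\<lambda>s. E s *v g s) integrable_on {s..t}" if "a \<le> s" "t \<le> b" for s t
    using that g cE by (intro ae_bounded_integrable ae_bounded_matrix_vector_mult)
      (auto intro: ae_bounded_subset)
  have E'G: "(\<lambda>s. E' s *v G s) integrable_on {s..t}" if "a \<le> s" "t \<le> b" for s t
    using that by (intro integrable_continuous_interval mv.continuous_on cE' continuous_on_subset[OF cG]) auto
  define F where "F t = integral {a..t} (\<lambda>s. E s *v g s) - E t *v G t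
    + integral {a..t} (\<lambda>s. E' s *v G s)" for t
  have "F a = F b"
  proof (rule eq_if_quadratic_increments[OF ab])
    fix s t assume st: "a \<le> s" "s \<le> t" "t \<le> b"
    have lipG: "norm (G r - G s) \<le> K * (t - s)" if r: "r \<in> {s..t}" for r
    proof -
      have "norm (G r - G s) \<le> K * (r - s)"
      proof -
        have "AE x in lebesgue. x \<in> {s..r} \<longrightarrow> norm (g x) \<le> K"
          using K(2) by eventually_elim (use r st in auto)
        then have "norm (integral {s..r} g) \<le> K * (r - s)"
          using r st K by (intro norm_integral_le_if_AE gint) auto
        then show ?thesis using dG[of s r] r st by simp
      qed
      also have "\<dots> \<le> K * (t - s)" using r K by (intro mult_left_mono) auto
      finally show ?thesis .
    qed
    have lipE: "norm (E r - E t) \<le> M * (t - s)" if r: "r \<in> {s..t}" for r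
    proof -
      have "norm (E t - E r) \<le> M * measure lborel {r..t}"
        using has_integral_bound_real[OF M(1) finite.emptyI dE[of r t]] M(2) r st by auto
      also have "\<dots> \<le> M * (t - s)" using r M st by (auto intro!: mult_left_mono)
      finally show ?thesis by (simp add: norm_minus_commute)
    qed
    \<comment> \<open>E is frozen at the right end and G at the left end, matching E t G t - E s G s
      = E t (G t - G s) + (E t - E s) G s. Thus \<open>?D\<close> integrates to F t - F s, and each
      of its summands has a factor of order t - s.\<close>
    let ?D = "\<lambda>r. (E r - E t) *v g r + E' r *v (G r - G s)"
    have "(?D has_integral
       integral {s..t} (\<lambda>r. E r *v g r) - E t *v integral {s..t} g
       + (integral {s..t} (\<lambda>r. E' r *v G r) - (E t - E s) *v G s)) {s..t}"
      unfolding mv.diff_left mv.diff_right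
      by (intro has_integral_add has_integral_diff integrable_integral Eg E'G
          has_integral_linear[OF dE, OF _ mv.bounded_linear_left, unfolded o_def, unfolded mv.diff_left]
          has_integral_linear[OF integrable_integral, OF gint mv.bounded_linear_right, unfolded o_def] st)
    moreover have "integral {s..t} (\<lambda>r. E r *v g r) - E t *v integral {s..t} g
       + (integral {s..t} (\<lambda>r. E' r *v G r) - (E t - E s) *v G s) = F t - F s"
      using st dG[of s t] integral_diff_real[OF Eg, of a b s t] integral_diff_real[OF E'G, of a b s t]
      by (simp add: F_def algebra_simps mv.diff_left mv.diff_right)
    ultimately have D: "(?D has_integral F t - F s) {s..t}" by simp
    have "AE r in lebesgue. r \<in> {s..t} \<longrightarrow> norm (?D r) \<le> 2 * M * K * L * (t - s)"
      using K(2)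
    proof eventually_elim
      case (elim r)
      show ?case
      proof
        assume r: "r \<in> {s..t}"
        have "norm ((E r - E t) *v g r) \<le> (M * (t - s)) * K * L"
          using lipE[OF r] elim r st L K M
          by (intro order_trans[OF L(2)] mult_right_mono mult_mono) auto
        moreover have "norm (E' r *v (G r - G s)) \<le> M * (K * (t - s)) * L"
          using lipG[OF r] r st L K M
          by (intro order_trans[OF L(2)] mult_right_mono mult_mono) auto
        ultimately show "norm (?D r) \<le> 2 * M * K * L * (t - s)"
          by (intro order_trans[OF norm_triangle_ineq]) (simp add: algebra_simps)
      qed
    qed
    then have "norm (integral {s..t} ?D) \<le> 2 * M * K * L * (t - s) * (t - s)"
      using D st K M L by (intro norm_integral_le_if_AE) auto
    then show "norm (F t - F s) \<le> (2 * M * K * L) * (t - s)\<^sup>2"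
      using integral_unique[OF D] by (simp add: power2_eq_square mult.assoc)
  qed
  then show ?thesis by (simp add: F_def algebra_simps)
qed

section \<open>Variation of constants and existence of solutions\<close>

lemma has_vector_derivative_matrix_exp_minus:
  "((\<lambda>t. matrix_exp ((- t) *\<^sub>R A)) has_vector_derivative - (A ** matrix_exp ((- t) *\<^sub>R A))) (at t within S)"
  by (rule has_vector_derivative_eq_rhs[OF has_vector_derivative_matrix_exp_compose[where g'="-1"]])
    (auto intro!: derivative_eq_intros)

lemma integral_matrix_vector_mult:
  fixes f :: "real \<Rightarrow> real ^ 'n"
  assumes "f integrable_on S" shows "integral S (\<lambda>s. M *v f s) = M *v integral S f"
  using integral_linear[OF assms mv.bounded_linear_right[of M]] by (simp add: o_def)

text \<open>The existentially quantified state of \<open>lti_system\<close> becomes a parameter, so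
  that facts about the trajectory can be stated without the output.\<close>

locale forced_lti =
  fixes A :: "real ^ 'n ^ 'n" and B :: "real ^ 'm ^ 'n" and x0 :: "real ^ 'n"
    and u :: "real \<Rightarrow> real ^ 'm" and x :: "real \<Rightarrow> real ^ 'n"
  assumes ae_bounded_input: "ae_bounded S u"
    and solution: "0 \<le> t \<Longrightarrow> x t = x0 + integral {0..t} (\<lambda>s. A *v x s + B *v u s)"
    and field_integrable: "0 \<le> t \<Longrightarrow> (\<lambda>s. A *v x s + B *v u s) absolutely_integrable_on {0..t}"
begin

lemma continuous_on_solution: "continuous_on {0..} x"
proof -
  \<comment> \<open>Half-open intervals are neighbourhoods of their points relative to
    \<open>{0..}\<close>, so continuity on all of them is continuity on the whole half-line.\<close>
  have "continuous_on {0..<b} x" for b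
  proof -
    have "continuous_on {0..b} (\<lambda>t. x0 + integral {0..t} (\<lambda>s. A *v x s + B *v u s))"
    proof (cases "0 \<le> b")
      case True
      then show ?thesis
        using field_integrable[OF True]
        by (intro continuous_on_add continuous_on_const indefinite_integral_continuous_1)
          (rule set_lebesgue_integral_eq_integral(1))
    qed auto
    then have "continuous_on {0..<b} (\<lambda>t. x0 + integral {0..t} (\<lambda>s. A *v x s + B *v u s))"
      by (rule continuous_on_subset) auto
    then show ?thesis
      by (rule continuous_on_eq) (simp add: solution)
  qed
  moreover have "at t within {0..} = at t within {0..<t + 1}" for t :: real
    by (rule at_within_nhd[of _ "{..<t + 1}"]) auto
  ultimately have "continuous (at t within {0..}) x" if "0 \<le> t" for t
    using that unfolding continuous_on_eq_continuous_within
    by (metis atLeastLessThan_iff less_add_one)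
  then show ?thesis
    by (auto simp: continuous_on_eq_continuous_within)
qed

lemma ae_bounded_forcing: "ae_bounded {a..b} (\<lambda>s. B *v u s)"
  by (intro ae_bounded_matrix_vector_mult continuous_on_const ae_bounded_input)

lemma ae_bounded_exp_forcing:
  "continuous_on {a..b} g \<Longrightarrow> ae_bounded {a..b} (\<lambda>s. matrix_exp (g s *\<^sub>R A) *v (B *v u s))"
  by (intro ae_bounded_matrix_vector_mult continuous_intros ae_bounded_forcing)

text \<open>Integrating the vector field by parts against
  \<open>matrix_exp ((- s) *\<^sub>R A)\<close> cancels the terms in A x, since A commutes with its
  exponential.\<close>

lemma variation_of_constants:
  assumes t: "0 \<le> t"
  shows "x t = matrix_exp (t *\<^sub>R A) *v
    (x0 + integral {0..t} (\<lambda>s. matrix_exp ((- s) *\<^sub>R A) *v (B *v u s)))"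
proof -
  let ?E = "\<lambda>s. matrix_exp ((- s) *\<^sub>R A)"
  have cx: "continuous_on {0..t} x"
    by (rule continuous_on_subset[OF continuous_on_solution]) auto
  have x0: "x 0 = x0" using solution[of 0] by simp
  have "integral {0..t} (\<lambda>s. ?E s *v (A *v x s + B *v u s))
      = ?E t *v x t - ?E 0 *v x 0 - integral {0..t} (\<lambda>s. (- (A ** ?E s)) *v x s)"
  proof (rule integration_by_parts_matrix_vector[OF t has_vector_derivative_matrix_exp_minus])
    show "continuous_on UNIV (\<lambda>s. - (A ** ?E s))"
      by (intro continuous_intros mm.continuous_on)
    show "ae_bounded {0..t} (\<lambda>s. A *v x s + B *v u s)"
      by (intro ae_bounded_add ae_bounded_forcing ae_bounded_continuous mv.continuous_on cx continuous_on_const)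
    show "x s = x 0 + integral {0..s} (\<lambda>s. A *v x s + B *v u s)" if "s \<in> {0..t}" for s
      using solution[of s] that x0 by simp
  qed
  also have "integral {0..t} (\<lambda>s. (- (A ** ?E s)) *v x s) = - integral {0..t} (\<lambda>s. ?E s *v (A *v x s))"
    using matrix_exp_commute[of "- s" A for s]
    by (simp add: mv.minus_left matrix_vector_mul_assoc)
  also have "integral {0..t} (\<lambda>s. ?E s *v (A *v x s + B *v u s))
      = integral {0..t} (\<lambda>s. ?E s *v (A *v x s)) + integral {0..t} (\<lambda>s. ?E s *v (B *v u s))"
    unfolding mv.add_right
    by (intro Henstock_Kurzweil_Integration.integral_add ae_bounded_integrable
        ae_bounded_exp_forcing integrable_continuous_interval mv.continuous_on cx continuous_intros)
  finally have "?E t *v x t = x0 + integral {0..t} (\<lambda>s. ?E s *v (B *v u s))"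
    by (simp add: x0 algebra_simps)
  then have "matrix_exp (t *\<^sub>R A) *v (?E t *v x t)
      = matrix_exp (t *\<^sub>R A) *v (x0 + integral {0..t} (\<lambda>s. ?E s *v (B *v u s)))"
    by simp
  then show ?thesis
    by (simp only: matrix_vector_mul_assoc matrix_exp_minus matrix_vector_mul_lid)
qed

end

text \<open>The variation of constants formula is taken as the definition of x, and integration by
  parts shows that it solves the equation. Existence matters for the lower bounds: a gain is
  constrained only by outputs that occur.\<close>

lemma exists_solution:
  fixes A :: "real ^ 'n ^ 'n" and B :: "real ^ 'm ^ 'n"
  assumes u: "\<And>S. ae_bounded S u"
  shows "\<exists>x. forced_lti A B x0 u x"
proof -
  let ?E = "\<lambda>s. matrix_exp (s *\<^sub>R A)"
  define f where "f s = matrix_exp ((- s) *\<^sub>R A) *v (B *v u s)" for s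
  define p where "p t = x0 + integral {0..t} f" for t
  define x where "x t = ?E t *v p t" for t
  have Bu: "ae_bounded {a..b} (\<lambda>s. B *v u s)" for a b
    by (intro ae_bounded_matrix_vector_mult continuous_on_const u)
  have f: "ae_bounded {a..b} f" for a b
    unfolding f_def [abs_def] by (intro ae_bounded_matrix_vector_mult continuous_intros Bu)
  have cx: "continuous_on {0..t} x" for t
    unfolding x_def [abs_def] p_def
    by (intro mv.continuous_on continuous_on_matrix_exp continuous_on_id continuous_on_add
        continuous_on_const indefinite_integral_continuous_1 ae_bounded_integrable f)
  show ?thesis
  proof (rule exI, unfold_locales)
    show "ae_bounded S u" for S by (rule u)
    fix t :: real assume t: "0 \<le> t"
    have "ae_bounded {0..t} (\<lambda>s. A *v x s + B *v u s)"
      by (intro ae_bounded_add Bu ae_bounded_continuous mv.continuous_on cx continuous_on_const)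
    then show "(\<lambda>s. A *v x s + B *v u s) absolutely_integrable_on {0..t}"
      by (rule ae_bounded_absolutely_integrable)
    have "integral {0..t} (\<lambda>s. ?E s *v f s)
      = ?E t *v p t - ?E 0 *v p 0 - integral {0..t} (\<lambda>s. (A ** ?E s) *v p s)"
      by (rule integration_by_parts_matrix_vector[OF t has_vector_derivative_matrix_exp])
        (auto intro!: f continuous_intros mm.continuous_on simp: p_def)
    also have "(\<lambda>s. ?E s *v f s) = (\<lambda>s. B *v u s)"
    proof
      show "?E s *v f s = B *v u s" for s
        unfolding f_def matrix_vector_mul_assoc[of "?E s" _ "B *v u s"] matrix_exp_minus by simp
    qed
    also have "(\<lambda>s. (A ** ?E s) *v p s) = (\<lambda>s. A *v x s)"
      by (simp add: x_def matrix_vector_mul_assoc)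
    finally have "x t = x0 + (integral {0..t} (\<lambda>s. A *v x s) + integral {0..t} (\<lambda>s. B *v u s))"
      by (simp add: x_def p_def algebra_simps)
    also have "integral {0..t} (\<lambda>s. A *v x s) + integral {0..t} (\<lambda>s. B *v u s)
      = integral {0..t} (\<lambda>s. A *v x s + B *v u s)"
      by (intro Henstock_Kurzweil_Integration.integral_add[symmetric] ae_bounded_integrable Bu
          ae_bounded_continuous mv.continuous_on cx continuous_on_const)
    finally show "x t = x0 + integral {0..t} (\<lambda>s. A *v x s + B *v u s)" .
  qed
qed

section \<open>The periodic steady state\<close>

text \<open>The complements of the two windows in \<open>{0..t}\<close> are translates of each other
  by T.\<close>

lemma integral_periodic_window:
  fixes f :: "real \<Rightarrow> 'a::euclidean_space"
  assumes "\<And>s. f (s + T) = f s" "f integrable_on {0..t}" "0 \<le> T" "T \<le> t"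
  shows "integral {t - T..t} f = integral {0..T} f"
proof -
  have "integral {0..t - T} f = integral {T..t} f"
    using integral_shift_real_ivl[of T T t f] assms(1) by simp
  moreover have "integral {0..t} f - integral {0..T} f = integral {T..t} f"
    "integral {0..t} f - integral {0..t - T} f = integral {t - T..t} f"
    using assms by (intro integral_diff_real[OF assms(2)]; simp)+
  ultimately show ?thesis by (metis diff_diff_eq2 add_diff_cancel_left' diff_add_cancel)
qed

text \<open>F receives the value of u as an argument, so the same fact serves
  \<open>forced_window\<close> and \<open>ac_response\<close>.\<close>

lemma integral_convolution_shift:
  fixes u :: "real \<Rightarrow> 'b"
  assumes "\<And>s. u (s + T) = u s"
  shows "integral {t..t + T} (\<lambda>s. F (t + T - s) (u s)) = integral {t - T..t} (\<lambda>s. F (t - s) (u s))"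
  using integral_shift_real_ivl[of t T "t + T" "\<lambda>s. F (t + T - s) (u s)"] assms by simp

locale periodic_lti = forced_lti A B x0 u x
  for A :: "real ^ 'n ^ 'n" and B :: "real ^ 'm ^ 'n" and x0 u x +
  fixes C :: "real ^ 'n ^ 'p" and T :: real and y :: "real \<Rightarrow> real ^ 'p"
  assumes hurwitz: "hurwitz A" and T: "0 < T" and periodic_input: "u (t + T) = u t"
    and output_eq: "0 \<le> t \<Longrightarrow> y t = C *v x t"
begin

abbreviation "E t \<equiv> matrix_exp (t *\<^sub>R A)"
abbreviation "R \<equiv> matrix_inv (mat 1 - E T)"
abbreviation "H \<equiv> periodic_impulse_response A B C T"

definition input_mean :: "real ^ 'm" where
  "input_mean = (1 / T) *\<^sub>R integral {0..T} u"

text \<open>The contribution of the latest period of the input alone; \<open>R\<close> sums the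
  geometric series that repeats it over all earlier periods.\<close>

definition forced_window :: "real \<Rightarrow> real ^ 'n" where
  "forced_window t = integral {t - T..t} (\<lambda>s. E (t - s) *v (B *v u s))"

lemma moving_avg_input: "T \<le> t \<Longrightarrow> moving_avg T u t = input_mean"
  unfolding moving_avg_def input_mean_def
  using T integral_periodic_window[of u T t, OF periodic_input ae_bounded_integrable[OF ae_bounded_input]]
  by simp

lemma forced_window_periodic: "forced_window (t + T) = forced_window t"
  unfolding forced_window_def
  using integral_convolution_shift[of u T t "\<lambda>s v. E s *v (B *v v)", OF periodic_input] by simp

lemma E_split: "E (t - s) *v v = E t *v (matrix_exp ((- s) *\<^sub>R A) *v v)"
  using matrix_exp_add[of t "- s" A] by (simp add: matrix_vector_mul_assoc)

lemma R_inverse: "R ** (mat 1 - E T) = mat 1"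
  using hurwitz_invertible_one_minus_exp[OF hurwitz T] by (rule matrix_inv_left)

lemma R_commute: "E t ** R = R ** E t"
  by (rule matrix_inv_exp_commute[OF hurwitz T])

text \<open>The term with \<open>R\<close> is the periodic steady state; every solution differs from it by a free motion.\<close>

lemma solution_decomposition:
  obtains c where "\<And>t. T \<le> t \<Longrightarrow> x t = R *v forced_window t + E t *v c"
proof
  let ?f = "\<lambda>s. matrix_exp ((- s) *\<^sub>R A) *v (B *v u s)"
  define P where "P t = integral {0..t} ?f" for t
  fix t assume t: "T \<le> t"
  have f: "ae_bounded {a..b} ?f" for a b
    by (intro ae_bounded_exp_forcing continuous_intros)
  have int: "?f integrable_on {0..t}"
    by (intro ae_bounded_integrable f)
  \<comment> \<open>Periodicity of u turns the shift by T into the factor \<open>E T\<close>. Hence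
    P t - P (t - T) is (1 - E T) P t plus a constant, \<open>R\<close> undoes the first factor, and
    the constant ends up in the witness c.\<close>
  have "P (t - T) = integral {T..t} (\<lambda>s. ?f (s - T))"
    using integral_shift_real_ivl[of T T t "\<lambda>s. ?f (s - T)"] by (simp add: P_def)
  also have "\<dots> = integral {T..t} (\<lambda>s. E T *v ?f s)"
    using E_split[of T s for s] periodic_input[of "s - T" for s] by simp
  also have "\<dots> = E T *v integral {T..t} ?f"
    by (intro integral_matrix_vector_mult ae_bounded_integrable f)
  also have "integral {T..t} ?f = P t - P T"
    unfolding P_def by (rule integral_diff_real[OF int, symmetric]) (use T t in auto)
  finally have Pshift: "P (t - T) = E T *v (P t - P T)" .
  have "forced_window t = integral {t - T..t} (\<lambda>s. E t *v ?f s)"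
    by (simp add: forced_window_def E_split)
  also have "\<dots> = E t *v integral {t - T..t} ?f"
    by (intro integral_matrix_vector_mult ae_bounded_integrable f)
  also have "integral {t - T..t} ?f = P t - P (t - T)"
    unfolding P_def by (rule integral_diff_real[OF int, symmetric]) (use T t in auto)
  also have "\<dots> = (mat 1 - E T) *v P t + E T *v P T"
    by (simp add: Pshift mv.diff_left mv.diff_right)
  finally have "R *v forced_window t
      = E t *v ((R ** (mat 1 - E T)) *v P t) + E t *v (R *v (E T *v P T))"
    by (simp add: mv.add_right matrix_vector_mul_assoc R_commute matrix_mul_assoc)
  then have "R *v forced_window t = E t *v P t + E t *v (R *v (E T *v P T))"
    by (simp add: R_inverse)
  moreover have "x t = E t *v (x0 + P t)"
    using variation_of_constants[of t] t T by (simp add: P_def)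
  ultimately show "x t = R *v forced_window t + E t *v (x0 - R *v (E T *v P T))"
    by (simp add: mv.add_right mv.diff_right)
qed

lemma flow_tendsto_0: "((\<lambda>t. E t *v c) \<longlongrightarrow> 0) at_top"
  using mv.tendsto[OF hurwitz_matrix_exp_tendsto_0[OF hurwitz] tendsto_const[of c]] by simp

lemma H_eq: "H t = C ** E t ** R ** B"
  by (rule periodic_impulse_response_eq[OF hurwitz T])

lemma output_forced_window:
  "C *v (R *v forced_window t) = integral {t - T..t} (\<lambda>s. H (t - s) *v u s)"
proof -
  have "C *v (R *v forced_window t) = (C ** R) *v integral {t - T..t} (\<lambda>s. E (t - s) *v (B *v u s))"
    by (simp add: forced_window_def matrix_vector_mul_assoc)
  also have "\<dots> = integral {t - T..t} (\<lambda>s. (C ** R) *v (E (t - s) *v (B *v u s)))"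
    by (intro integral_matrix_vector_mult[symmetric] ae_bounded_integrable ae_bounded_exp_forcing continuous_intros)
  also have "\<dots> = integral {t - T..t} (\<lambda>s. H (t - s) *v u s)"
    by (simp add: H_eq matrix_vector_mul_assoc matrix_mul_assoc[symmetric] R_commute)
  finally show ?thesis .
qed

lemma continuous_on_H: "continuous_on S g \<Longrightarrow> continuous_on S (\<lambda>t. H (g t))"
  unfolding H_eq by (intro mm.continuous_on continuous_intros)

text \<open>An antiderivative of \<open>E (t - s)\<close> is - A^-1 E (t - s); over one period it
  grows by - A^-1 (1 - E T), and the last factor cancels against \<open>R\<close>.\<close>

lemma integral_H: "((\<lambda>s. H (t - s)) has_integral dc_gain A B C) {t - T..t}"
proof -
  let ?I = "matrix_inv A"
  have I: "?I ** A = mat 1"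
    using hurwitz_invertible[OF hurwitz] by (rule matrix_inv_left)
  have "((\<lambda>s. - (?I ** E (t - s))) has_vector_derivative E (t - s)) (at s within {t - T..t})" for s
    by (rule has_vector_derivative_eq_rhs[OF has_vector_derivative_minus[OF
          bounded_linear.has_vector_derivative[OF mm.bounded_linear_right
            has_vector_derivative_matrix_exp_compose[where g'="-1"]]]])
      (auto intro!: derivative_eq_intros simp: mm.minus_right matrix_mul_assoc I)
  from fundamental_theorem_of_calculus[OF _ this]
  have "((\<lambda>s. E (t - s)) has_integral - (?I ** (mat 1 - E T))) {t - T..t}"
    using T by (simp add: mm.diff_right)
  from has_integral_linear[OF this bounded_linear_compose[OF
        mm.bounded_linear_right[of C] mm.bounded_linear_left[of "R ** B"]]]
  have "((\<lambda>s. C ** (E (t - s) ** (R ** B))) has_integral C ** (- (?I ** (mat 1 - E T)) ** (R ** B))) {t - T..t}"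
    by (simp add: o_def)
  moreover have "C ** (- (?I ** (mat 1 - E T)) ** (R ** B)) = - (C ** (?I ** (((mat 1 - E T) ** R) ** B)))"
    by (simp add: mm.minus_left mm.minus_right matrix_mul_assoc)
  moreover have "(mat 1 - E T) ** R = mat 1"
    using hurwitz_invertible_one_minus_exp[OF hurwitz T] by (rule matrix_inv_right)
  ultimately show ?thesis
    by (simp add: H_eq dc_gain_def matrix_mul_assoc)
qed

lemma ae_bounded_H_input: "ae_bounded {a..b} (\<lambda>s. H (t - s) *v (u s - input_mean))"
proof -
  have "ae_bounded {a..b} (\<lambda>s. u s + (- input_mean))"
    by (intro ae_bounded_add ae_bounded_input ae_bounded_continuous continuous_on_const)
  then show ?thesis
    by (intro ae_bounded_matrix_vector_mult continuous_on_H continuous_intros) simp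
qed

lemma convolution_split:
  "integral {t - T..t} (\<lambda>s. H (t - s) *v u s)
    = dc_gain A B C *v input_mean + integral {t - T..t} (\<lambda>s. H (t - s) *v (u s - input_mean))"
proof -
  have "((\<lambda>s. H (t - s) *v input_mean) has_integral dc_gain A B C *v input_mean) {t - T..t}"
    using has_integral_linear[OF integral_H mv.bounded_linear_left] by (simp add: o_def)
  from has_integral_add[OF this integrable_integral[OF ae_bounded_integrable[OF ae_bounded_H_input[where t=t]]]]
  show ?thesis
    by (intro integral_unique) (simp add: mv.diff_right)
qed

text \<open>Integrating the differential equation over one period expresses the mean of the state by
  its increment, which makes Fubini's theorem unnecessary.\<close>

lemma moving_avg_output:
  assumes t: "T \<le> t"
  shows "moving_avg T y t = dc_gain A B C *v input_mean
    + (1 / T) *\<^sub>R (C *v (matrix_inv A *v (x t - x (t - T))))"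
proof -
  let ?I = "matrix_inv A"
  have I: "?I ** A = mat 1"
    using hurwitz_invertible[OF hurwitz] by (rule matrix_inv_left)
  have cx: "continuous_on {t - T..t} x"
    by (rule continuous_on_subset[OF continuous_on_solution]) (use t in auto)
  have xint: "x integrable_on {t - T..t}"
    by (intro integrable_continuous_interval cx)
  have "x t - x (t - T) = integral {t - T..t} (\<lambda>s. A *v x s + B *v u s)"
    using solution[of t] solution[of "t - T"] T t
      integral_diff_real[OF set_lebesgue_integral_eq_integral(1)[OF field_integrable[of t]], of "t - T" t]
    by simp
  also have "\<dots> = A *v integral {t - T..t} x + B *v integral {t - T..t} u"
  proof -
    have "(\<lambda>s. A *v x s) integrable_on {t - T..t}"
      by (intro integrable_continuous_interval mv.continuous_on cx continuous_on_const)
    moreover have "(\<lambda>s. B *v u s) integrable_on {t - T..t}" "u integrable_on {t - T..t}"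
      by (intro ae_bounded_integrable ae_bounded_forcing ae_bounded_input)+
    ultimately show ?thesis
      by (simp add: Henstock_Kurzweil_Integration.integral_add integral_matrix_vector_mult xint)
  qed
  also have "integral {t - T..t} u = T *\<^sub>R input_mean"
    using moving_avg_input[OF t, unfolded moving_avg_def, symmetric] T by simp
  finally have "?I *v (x t - x (t - T)) = integral {t - T..t} x + T *\<^sub>R (?I *v (B *v input_mean))"
    by (simp add: mv.add_right mv.scaleR_right matrix_vector_mul_assoc I)
  then have int_x: "integral {t - T..t} x = ?I *v (x t - x (t - T)) - T *\<^sub>R (?I *v (B *v input_mean))"
    by simp
  have "integral {t - T..t} y = C *v integral {t - T..t} x"
    using t by (subst integral_matrix_vector_mult[OF xint, symmetric])
      (auto intro!: Henstock_Kurzweil_Integration.integral_cong output_eq)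
  also have "\<dots> = C *v (?I *v (x t - x (t - T))) - T *\<^sub>R (C *v (?I *v (B *v input_mean)))"
    unfolding int_x by (simp only: mv.diff_right mv.scaleR_right)
  finally have "moving_avg T y t
      = (1 / T) *\<^sub>R (C *v (?I *v (x t - x (t - T)))) - C *v (?I *v (B *v input_mean))"
    using T by (simp add: moving_avg_def scaleR_diff_right)
  moreover have "dc_gain A B C *v input_mean = - (C *v (?I *v (B *v input_mean)))"
    by (simp add: dc_gain_def mv.minus_left matrix_vector_mul_assoc matrix_mul_assoc)
  ultimately show ?thesis
    by simp
qed

lemma moving_avg_output_tendsto: "((\<lambda>t. moving_avg T y t) \<longlongrightarrow> dc_gain A B C *v input_mean) at_top"
proof -
  obtain c where c: "\<And>t. T \<le> t \<Longrightarrow> x t = R *v forced_window t + E t *v c"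
    using solution_decomposition by blast
  define e where "e t = E t *v (c - matrix_exp ((- T) *\<^sub>R A) *v c)" for t
  \<comment> \<open>The periodic part cancels in the increment. The bound is \<open>2 * T\<close>
    because the decomposition is used at t and at t - T, both of which must be at least T.\<close>
  have "x t - x (t - T) = e t" if "2 * T \<le> t" for t
    using c[of t] c[of "t - T"] forced_window_periodic[of "t - T"] that T
    by (simp add: e_def mv.diff_right E_split)
  moreover have "((\<lambda>t. dc_gain A B C *v input_mean + (1 / T) *\<^sub>R (C *v (matrix_inv A *v e t)))
      \<longlongrightarrow> dc_gain A B C *v input_mean + (1 / T) *\<^sub>R (C *v (matrix_inv A *v 0))) at_top"
    unfolding e_def by (intro tendsto_intros mv.tendsto flow_tendsto_0)
  ultimately have "((\<lambda>t. moving_avg T y t)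
      \<longlongrightarrow> dc_gain A B C *v input_mean + (1 / T) *\<^sub>R (C *v (matrix_inv A *v 0))) at_top"
    by (elim Lim_transform_eventually)
      (use T in \<open>auto simp: moving_avg_output intro!: eventually_mono[OF eventually_ge_at_top[of "2 * T"]]\<close>)
  then show ?thesis by simp
qed

text \<open>Unlike \<open>y - moving_avg T y\<close>, which only approaches it, this function is
  exactly periodic, so a value at one instant recurs at arbitrarily late times.\<close>

definition ac_response :: "real \<Rightarrow> real ^ 'p" where
  "ac_response t = integral {t - T..t} (\<lambda>s. H (t - s) *v (u s - input_mean))"

lemma ac_response_periodic: "ac_response (t + T) = ac_response t"
  unfolding ac_response_def
  using integral_convolution_shift[of u T t "\<lambda>s v. H s *v (v - input_mean)", OF periodic_input] by simp

lemma ac_output_tendsto: "((\<lambda>t. y t - moving_avg T y t - ac_response t) \<longlongrightarrow> 0) at_top"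
proof -
  obtain c where c: "\<And>t. T \<le> t \<Longrightarrow> x t = R *v forced_window t + E t *v c"
    using solution_decomposition by blast
  have y: "y t = dc_gain A B C *v input_mean + ac_response t + C *v (E t *v c)" if "T \<le> t" for t
    using output_eq[of t] c[OF that] T that output_forced_window[of t] convolution_split[of t]
    by (simp add: mv.add_right ac_response_def)
  have "((\<lambda>t. dc_gain A B C *v input_mean + C *v (E t *v c) - moving_avg T y t)
    \<longlongrightarrow> dc_gain A B C *v input_mean + C *v 0 - dc_gain A B C *v input_mean) at_top"
    by (intro tendsto_intros mv.tendsto flow_tendsto_0 moving_avg_output_tendsto)
  then have "((\<lambda>t. y t - moving_avg T y t - ac_response t)
    \<longlongrightarrow> dc_gain A B C *v input_mean + C *v 0 - dc_gain A B C *v input_mean) at_top"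
    by (elim Lim_transform_eventually)
      (auto simp: y intro!: eventually_mono[OF eventually_ge_at_top[of T]])
  then show ?thesis by simp
qed

lemma continuous_on_output: "continuous_on {0..} y"
  by (rule continuous_on_eq[where f="\<lambda>t. C *v x t"])
    (auto intro!: mv.continuous_on continuous_on_solution continuous_intros simp: output_eq)

lemma continuous_on_moving_avg_output: "continuous_on {T..} (moving_avg T y)"
proof (rule continuous_on_eq)
  show "continuous_on {T..} (\<lambda>t. dc_gain A B C *v input_mean
    + (1 / T) *\<^sub>R (C *v (matrix_inv A *v (x t - x (t - T)))))"
    using T by (intro continuous_intros mv.continuous_on continuous_on_subset[OF continuous_on_solution]
        continuous_on_compose2[OF continuous_on_solution]) auto
qed (simp add: moving_avg_output)

end

section \<open>Essential limit superior and deviation from the median\<close>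

lemma ess_limsup_upper:
  assumes "g \<in> borel_measurable (lebesgue_on {s..})" "\<And>t. s \<le> t \<Longrightarrow> g t \<le> c"
  shows "ess_limsup g \<le> c"
  unfolding ess_limsup_def
proof (rule INF_lower2[of s])
  show "esssup (lebesgue_on {s..}) g \<le> c"
    using assms by (intro esssup_I AE_I2) auto
qed simp

text \<open>For a continuous function a sublevel set is closed, so a bound that holds almost
  everywhere on an open ray holds everywhere on it; values along any sequence tending to infinity
  therefore count.\<close>

lemma ess_limsup_lower:
  fixes g :: "real \<Rightarrow> real"
  assumes g: "continuous_on {a..} g"
    and r: "filterlim r at_top sequentially" and l: "(\<lambda>k. g (r k)) \<longlonglongrightarrow> l"
  shows "ereal l \<le> ess_limsup (\<lambda>t. ereal (g t))"
  unfolding ess_limsup_def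
proof (rule INF_greatest)
  fix s
  let ?e = "esssup (lebesgue_on {s..}) (\<lambda>t. ereal (g t))"
  define b where "b = max a s"
  define C where "C = {b..} \<inter> (\<lambda>t. ereal (g t)) -` {..?e}"
  have "closed C"
    unfolding C_def
    by (intro continuous_closed_preimage continuous_on_ereal continuous_on_subset[OF g])
      (auto simp: b_def)
  moreover have "AE t in lebesgue. t \<in> {s..} \<longrightarrow> ereal (g t) \<le> ?e"
    using esssup_AE[of "\<lambda>t. ereal (g t)" "lebesgue_on {s..}"] by (simp add: AE_restrict_space_iff)
  then have "AE t \<in> {b<..} in lebesgue. t \<in> C"
    by eventually_elim (auto simp: C_def b_def)
  ultimately have C: "t \<in> C" if "b < t" for t
    using mem_closed_if_AE_lebesgue_open[of "{b<..}" C t] that by auto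
  have "\<forall>\<^sub>F k in sequentially. ereal (g (r k)) \<le> ?e"
    using filterlim_at_top_dense[THEN iffD1, OF r, rule_format, of b]
    by eventually_elim (use C in \<open>auto simp: C_def\<close>)
  then show "ereal l \<le> ?e"
    using l by (intro tendsto_upperbound[of "\<lambda>k. ereal (g (r k))" "ereal l" sequentially]) auto
qed

lemma ess_limsup_less_imp_AE:
  assumes "ess_limsup g < c"
  obtains s where "AE t in lebesgue. s \<le> t \<longrightarrow> g t \<le> c"
proof -
  obtain s where s: "esssup (lebesgue_on {s..}) g < c"
    using assms by (auto simp: ess_limsup_def INF_less_iff)
  have "AE t in lebesgue. t \<in> {s..} \<longrightarrow> g t \<le> esssup (lebesgue_on {s..}) g"
    using esssup_AE[of g "lebesgue_on {s..}"] by (simp add: AE_restrict_space_iff)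
  then have "AE t in lebesgue. s \<le> t \<longrightarrow> g t \<le> c"
    by eventually_elim (use s in auto)
  then show ?thesis by (rule that)
qed

text \<open>Each ray has positive measure; over a null space the essential supremum would be minus
  infinity.\<close>

lemma ess_limsup_nonneg:
  assumes "\<And>t. 0 \<le> g t"
  shows "0 \<le> ess_limsup g"
  unfolding ess_limsup_def
proof (rule INF_greatest)
  fix s :: real
  have "emeasure lebesgue {s..s + 1} \<le> emeasure lebesgue {s..}"
    by (intro emeasure_mono) auto
  then have "emeasure (lebesgue_on {s..}) (space (lebesgue_on {s..})) \<noteq> 0"
    by (auto simp: emeasure_restrict_space)
  from esssup_const[OF this, of "0 :: ereal"]
  show "0 \<le> esssup (lebesgue_on {s..}) g"
    using esssup_mono[of "\<lambda>_. 0" "lebesgue_on {s..}" g] assms by simp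
qed

section \<open>The mean deviation and its dual\<close>

lemma D_med_bounds:
  fixes f :: "real \<Rightarrow> real ^ 'm"
  assumes "0 < T"
  shows D_med_le: "D_med T f \<le> (1 / T) * integral {0..T} (\<lambda>t. norm (f t - \<mu>))"
    and D_med_nonneg: "0 \<le> D_med T f"
proof -
  have nn: "0 \<le> (1 / T) * integral {0..T} (\<lambda>t. norm (f t - \<mu>))" for \<mu>
    \<comment> \<open>Where the deviation is not integrable its integral is 0 by convention, so the
      bound holds for every \<open>f\<close>.\<close>
    using assms by (cases "(\<lambda>t. norm (f t - \<mu>)) integrable_on {0..T}")
      (auto intro!: divide_nonneg_pos Henstock_Kurzweil_Integration.integral_nonneg
        simp: not_integrable_integral)
  show "D_med T f \<le> (1 / T) * integral {0..T} (\<lambda>t. norm (f t - \<mu>))"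
    unfolding D_med_def by (intro cINF_lower bdd_belowI2[of _ 0] nn) auto
  show "0 \<le> D_med T f"
    unfolding D_med_def by (intro cINF_greatest nn) auto
qed

lemma D_med_greatest:
  assumes "\<And>\<mu>. b \<le> (1 / T) * integral {0..T} (\<lambda>t. norm (f t - \<mu>))"
  shows "b \<le> D_med T f"
  unfolding D_med_def by (intro cINF_greatest assms) auto

text \<open>The smoothed functional is differentiable, unlike the mean deviation itself. Its derivative
  vanishes at a minimiser \<open>\<mu>\<close>, which says that the smoothed unit vector field
  \<open>(f - \<mu>) / sqrt (norm (f - \<mu>)\<^sup>2 + \<epsilon>\<^sup>2)\<close> has mean zero.\<close>

lemma D_med_dual_approx:
  fixes f :: "real \<Rightarrow> real ^ 'm"
  assumes f: "continuous_on UNIV f" and T: "0 < T" and e: "0 < \<epsilon>"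
  obtains g where "continuous_on UNIV g" "\<And>t. norm (g t) \<le> 1" "integral {0..T} g = 0"
    "T * D_med T f \<le> integral {0..T} (\<lambda>t. f t \<bullet> g t) + \<epsilon> * T"
proof -
  have cf: "continuous_on S f" for S
    using f continuous_on_subset by blast
  define S where "S \<mu> t = sqrt ((f t - \<mu>) \<bullet> (f t - \<mu>) + \<epsilon>\<^sup>2)" for \<mu> t
  have pos: "0 < (f t - \<mu>) \<bullet> (f t - \<mu>) + \<epsilon>\<^sup>2" for \<mu> t
    using e by (intro add_nonneg_pos) auto
  have Spos: "0 < S \<mu> t" for \<mu> t
    using pos by (simp add: S_def)
  have S_ge: "norm (f t - \<mu>) \<le> S \<mu> t" "\<epsilon> \<le> S \<mu> t" for \<mu> t
    using e by (auto simp: S_def dot_square_norm intro!: real_le_rsqrt)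
  have cS: "continuous_on U (S \<mu>)" for U \<mu>
    unfolding S_def [abs_def] by (intro continuous_intros cf)
  have S_int: "S \<mu> integrable_on {0..T}" for \<mu>
    by (intro integrable_continuous_interval cS)
  define J where "J \<mu> = integral {0..T} (S \<mu>)" for \<mu>
  have "continuous_on (UNIV \<times> cbox 0 T) (\<lambda>(\<mu>, t). S \<mu> t)"
    unfolding S_def case_prod_beta
    by (intro continuous_intros continuous_on_compose2[OF f]) auto
  from integral_continuous_on_param[OF this]
  have cJ: "continuous_on U J" for U
    unfolding J_def by (auto intro: continuous_on_subset)
  \<comment> \<open>Since J \<mu> is at least T * norm \<mu> minus the integral of norm f, this is
    the radius beyond which J exceeds J 0; a minimum over the ball is then global.\<close>
  define r where "r = (J 0 + integral {0..T} (\<lambda>t. norm (f t))) / T"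
  have J_gt: "J 0 < J \<mu>" if "r < norm \<mu>" for \<mu>
  proof -
    have "integral {0..T} (\<lambda>t. norm \<mu> - norm (f t)) \<le> J \<mu>"
      unfolding J_def
    proof (intro integral_le S_int integrable_continuous_interval continuous_intros cf)
      fix t
      show "norm \<mu> - norm (f t) \<le> S \<mu> t"
        using S_ge(1)[of t \<mu>] norm_triangle_ineq2[of \<mu> "f t"] by (simp add: norm_minus_commute)
    qed
    also have "integral {0..T} (\<lambda>t. norm \<mu> - norm (f t)) = T * norm \<mu> - integral {0..T} (\<lambda>t. norm (f t))"
      using T by (subst Henstock_Kurzweil_Integration.integral_diff)
        (auto intro!: integrable_continuous_interval continuous_intros cf)
    finally show ?thesis
      using that T by (simp add: r_def field_simps)
  qed
  have "0 \<le> J 0"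
    unfolding J_def using S_int Spos[THEN less_imp_le]
    by (intro Henstock_Kurzweil_Integration.integral_nonneg) auto
  moreover have "0 \<le> integral {0..T} (\<lambda>t. norm (f t))"
    by (intro Henstock_Kurzweil_Integration.integral_nonneg integrable_continuous_interval
        continuous_intros cf) auto
  ultimately  have "0 \<le> r" using T by (simp add: r_def)
  then obtain \<mu> where \<mu>: "\<mu> \<in> cball 0 r" "\<And>\<nu>. \<nu> \<in> cball 0 r \<Longrightarrow> J \<mu> \<le> J \<nu>"
    using continuous_attains_inf[of "cball 0 r" J] cJ by auto
  have min: "J \<mu> \<le> J \<nu>" for \<nu>
  proof (cases "norm \<nu> \<le> r")
    case False
    then show ?thesis using J_gt[of \<nu>] \<mu>(2)[of 0] \<open>0 \<le> r\<close> by auto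
  qed (use \<mu> in auto)
  define g where "g t = (1 / S \<mu> t) *\<^sub>R (f t - \<mu>)" for t
  have cg: "continuous_on U g" for U
    unfolding g_def [abs_def] using Spos[of \<mu>]
    by (intro continuous_intros cS cf) (auto simp: less_le)
  have gint: "g integrable_on {0..T}"
    by (intro integrable_continuous_interval cg)
  have g0: "integral {0..T} g = 0"
  proof -
    have "integral {0..T} g \<bullet> h = 0" for h
    proof -
      let ?D = "\<lambda>s t. (1 / S (\<mu> + s *\<^sub>R h) t) * ((f t - (\<mu> + s *\<^sub>R h)) \<bullet> (- h))"
      have "((\<lambda>s. integral (cbox 0 T) (S (\<mu> + s *\<^sub>R h))) has_field_derivative
          integral (cbox 0 T) (?D 0)) (at 0 within UNIV)"
      proof (rule leibniz_rule_field_derivative)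
        fix s t
        have "((\<lambda>s. (f t - (\<mu> + s *\<^sub>R h)) \<bullet> (f t - (\<mu> + s *\<^sub>R h)) + \<epsilon>\<^sup>2) has_real_derivative
            2 * ((f t - (\<mu> + s *\<^sub>R h)) \<bullet> (- h))) (at s)"
          unfolding has_field_derivative_def
          by (auto intro!: derivative_eq_intros simp: fun_eq_iff inner_commute algebra_simps)
        from DERIV_chain2[OF DERIV_real_sqrt[OF pos[of t "\<mu> + s *\<^sub>R h"]] this]
        show "((\<lambda>s. S (\<mu> + s *\<^sub>R h) t) has_real_derivative ?D s t) (at s within UNIV)"
          unfolding S_def by (simp add: field_simps)
      next
        show "continuous_on (UNIV \<times> cbox 0 T) (\<lambda>(s, t). ?D s t)"
          unfolding case_prod_beta S_def using pos
          by (intro continuous_intros continuous_on_compose2[OF f]) (auto simp: less_le)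
      qed (use S_int in auto)
      then have "((\<lambda>s. J (\<mu> + s *\<^sub>R h)) has_real_derivative integral {0..T} (?D 0)) (at 0)"
        by (simp add: J_def)
      then have "integral {0..T} (?D 0) = 0"
        by (rule DERIV_local_min[where d=1]) (use min in auto)
      moreover have "?D 0 = (\<lambda>t. - (g t \<bullet> h))"
        by (simp add: g_def)
      ultimately have "integral {0..T} (\<lambda>t. - (g t \<bullet> h)) = 0"
        by (simp only:)
      then show ?thesis
        using integral_linear[OF gint bounded_linear_inner_left[of h]] by (simp add: o_def)
    qed
    then show ?thesis by (metis inner_eq_zero_iff)
  qed
  have g_norm: "norm (g t) \<le> 1" for t
    using S_ge(1)[of t \<mu>] Spos[of \<mu> t] by (simp add: g_def)
  have "T * D_med T f \<le> integral {0..T} (\<lambda>t. norm (f t - \<mu>))"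
    using D_med_le[OF T, of f \<mu>] T by (simp add: field_simps)
  also have "\<dots> \<le> integral {0..T} (\<lambda>t. f t \<bullet> g t - \<mu> \<bullet> g t + \<epsilon>)"
  proof (intro integral_le integrable_continuous_interval continuous_intros cf cg)
    fix t
    \<comment> \<open>Pointwise the smoothing costs at most \<epsilon>: the square of S exceeds that
      of norm (f - \<mu>) by \<epsilon>^2, which is at most \<epsilon> S, and dividing by S leaves
      the inner product with g.\<close>
    have sq: "S \<mu> t * S \<mu> t = (f t - \<mu>) \<bullet> (f t - \<mu>) + \<epsilon> * \<epsilon>"
      using pos[of t \<mu>] by (simp add: S_def power2_eq_square)
    have "\<epsilon> * \<epsilon> \<le> \<epsilon> * S \<mu> t"
      using S_ge(2)[of \<mu> t] e by (intro mult_left_mono) auto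
    then have "S \<mu> t * S \<mu> t \<le> (f t - \<mu>) \<bullet> (f t - \<mu>) + \<epsilon> * S \<mu> t"
      using sq by simp
    then have "S \<mu> t \<le> ((f t - \<mu>) \<bullet> (f t - \<mu>)) / S \<mu> t + \<epsilon>"
      using Spos[of \<mu> t] by (simp add: field_simps)
    also have "((f t - \<mu>) \<bullet> (f t - \<mu>)) / S \<mu> t = (f t - \<mu>) \<bullet> g t"
      by (simp add: g_def)
    finally have "S \<mu> t \<le> (f t - \<mu>) \<bullet> g t + \<epsilon>" .
    then show "norm (f t - \<mu>) \<le> f t \<bullet> g t - \<mu> \<bullet> g t + \<epsilon>"
      using S_ge(1)[of t \<mu>] by (simp add: inner_diff_left)
  qed
  also have "\<dots> = integral {0..T} (\<lambda>t. f t \<bullet> g t) - \<mu> \<bullet> integral {0..T} g + \<epsilon> * T"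
    using integral_linear[OF gint bounded_linear_inner_right[of \<mu>]] T
    by (subst Henstock_Kurzweil_Integration.integral_add Henstock_Kurzweil_Integration.integral_diff;
        (intro integrable_continuous_interval continuous_intros cf cg)?)+
      (simp add: o_def)
  finally show ?thesis
    using g0 by (intro that[of g] cg g_norm) auto
qed

section \<open>Magnitudes of the output\<close>

lemma ess_limsup_eq_lim:
  fixes g :: "real \<Rightarrow> real"
  assumes g: "continuous_on {a..} g" and l: "(g \<longlongrightarrow> l) at_top"
  shows "ess_limsup (\<lambda>t. ereal (g t)) = ereal l"
proof (rule antisym)
  show "ess_limsup (\<lambda>t. ereal (g t)) \<le> ereal l"
  proof (rule ereal_le_epsilon2)
    fix e :: real assume "0 < e"
    then have "\<forall>\<^sub>F t in at_top. g t < l + e"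
      using l by (intro order_tendstoD(2)[OF l]) auto
    then obtain s where s: "\<And>t. s \<le> t \<Longrightarrow> g t < l + e"
      unfolding eventually_at_top_linorder by blast
    have "ess_limsup (\<lambda>t. ereal (g t)) \<le> ereal (l + e)"
    proof (rule ess_limsup_upper[of _ "max a s"])
      show "(\<lambda>t. ereal (g t)) \<in> borel_measurable (lebesgue_on {max a s..})"
        by (intro borel_measurable_ereal continuous_imp_measurable_on_sets_lebesgue
            continuous_on_subset[OF g]) auto
    qed (use s in \<open>auto intro: less_imp_le\<close>)
    then show "ess_limsup (\<lambda>t. ereal (g t)) \<le> ereal l + ereal e" by simp
  qed
  show "ereal l \<le> ess_limsup (\<lambda>t. ereal (g t))"
    using ess_limsup_lower[OF g filterlim_real_sequentially]
      filterlim_compose[OF l filterlim_real_sequentially] by simp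
qed

lemma integral_le_AE:
  fixes f g :: "real \<Rightarrow> real"
  assumes f: "f integrable_on {a..b}" and g: "g integrable_on {a..b}"
    and le: "AE x in lebesgue. x \<in> {a..b} \<longrightarrow> f x \<le> g x"
  shows "integral {a..b} f \<le> integral {a..b} g"
proof -
  obtain N where N: "{x. \<not> (x \<in> {a..b} \<longrightarrow> f x \<le> g x)} \<subseteq> N" "negligible N"
    using le unfolding eventually_ae_filter negligible_iff_null_sets by auto
  define h where "h x = (if x \<in> N then g x else f x)" for x
  have h: "(h has_integral integral {a..b} f) {a..b}"
    by (rule has_integral_spike[OF N(2) _ integrable_integral[OF f]]) (simp add: h_def)
  show ?thesis
    by (rule has_integral_le[OF h integrable_integral[OF g]]) (use N in \<open>auto simp: h_def\<close>)
qed

lemma integral_reflect_window: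
  fixes h :: "real \<Rightarrow> 'a::real_normed_vector"
  shows "integral {t - T..t} (\<lambda>s. h (t - s)) = integral {0..T} h"
proof -
  have "integral {t - T..t} (\<lambda>s. h (t - s)) = integral {- T..- 0} (\<lambda>s. h (- s))"
    using integral_shift_real_ivl[of "t - T" t t "\<lambda>s. h (t - s)"] by simp
  then show ?thesis
    by (simp only: Henstock_Kurzweil_Integration.integral_reflect_real)
qed

text \<open>Reduces a bound on the vector-valued response to the kernels v v* H, whose mean
  deviations define \<open>gamma_ac\<close>.\<close>

lemma norm_le_if_inner_le:
  fixes a :: "'a::real_inner"
  assumes "\<And>v. norm v = 1 \<Longrightarrow> v \<bullet> a \<le> b" "0 \<le> b"
  shows "norm a \<le> b"
proof (cases "a = 0")
  case False
  then have "((1 / norm a) *\<^sub>R a) \<bullet> a \<le> b"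
    by (intro assms) simp
  then show ?thesis
    using False by (simp add: dot_square_norm power2_eq_square)
qed (use assms in simp)

text \<open>A real supremum dominates its members only if they are bounded above; the centre \<mu> =
  0 and the continuity of the impulse response on one period give a bound uniform in v.\<close>

lemma D_med_response_le_gamma_ac:
  fixes B :: "real ^ 'm ^ 'n" and C :: "real ^ 'n ^ 'p"
  assumes hurwitz: "hurwitz A" and T: "0 < T" and v: "norm v = 1"
  shows "T * D_med T (\<lambda>t. v v* periodic_impulse_response A B C T t) \<le> gamma_ac A B C T"
proof -
  let ?H = "periodic_impulse_response A B C T"
  let ?D = "\<lambda>v. D_med T (\<lambda>t. v v* ?H t)"
  have cH: "continuous_on S ?H" for S
    unfolding periodic_impulse_response_eq[OF hurwitz T, abs_def]
    by (intro mm.continuous_on continuous_intros)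
  interpret vm: bounded_bilinear "(v*) :: real^'p \<Rightarrow> real^'m^'p \<Rightarrow> real^'m"
    by (rule bounded_bilinear_vector_matrix_mult)
  obtain K where K: "\<And>(v :: real^'p) (M :: real^'m^'p). norm (v v* M) \<le> norm v * norm M * K"
    using vm.bounded by blast
  have "?D v \<le> (1 / T) * integral {0..T} (\<lambda>t. norm (?H t) * K)" if "v \<in> sphere 0 1" for v
  proof -
    have "?D v \<le> (1 / T) * integral {0..T} (\<lambda>t. norm (v v* ?H t - 0))"
      by (rule D_med_le[OF T])
    also have "\<dots> \<le> (1 / T) * integral {0..T} (\<lambda>t. norm (?H t) * K)"
      using T K[of v] that
      by (intro mult_left_mono integral_le integrable_continuous_interval continuous_intros
          vm.continuous_on cH) auto
    finally show ?thesis .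
  qed
  then have "bdd_above (?D ` sphere 0 1)"
    by (intro bdd_aboveI2)
  then have "?D v \<le> (SUP v\<in>sphere 0 1. ?D v)"
    using v by (intro cSUP_upper) auto
  then show ?thesis
    using T by (simp add: gamma_ac_def)
qed

lemma exists_norm_1: "\<exists>v :: real ^ 'p. norm v = 1"
  by (rule exI[of _ "axis undefined 1"]) simp

lemma gamma_ac_nonneg:
  assumes "hurwitz A" "0 < T" shows "0 \<le> gamma_ac A B (C :: real ^ 'n ^ 'p) T"
proof -
  obtain v :: "real ^ 'p" where "norm v = 1" using exists_norm_1 by blast
  from D_med_response_le_gamma_ac[OF assms this, of B C]
  show ?thesis
    using D_med_nonneg[OF assms(2)] assms(2) by (smt (verit) mult_nonneg_nonneg)
qed

lemma gamma_ac_le: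
  fixes C :: "real ^ 'n ^ 'p"
  assumes "0 < T" "\<And>v. norm v = 1 \<Longrightarrow> T * D_med T (\<lambda>t. v v* periodic_impulse_response A B C T t) \<le> b"
  shows "gamma_ac A B C T \<le> b"
proof -
  have "sphere 0 1 \<noteq> ({} :: (real ^ 'p) set)"
    using exists_norm_1 by auto
  then have "(SUP v\<in>sphere 0 1. D_med T (\<lambda>t. v v* periodic_impulse_response A B C T t)) \<le> b / T"
    using assms by (intro cSUP_least) (auto simp: field_simps)
  then show ?thesis
    using assms(1) by (simp add: gamma_ac_def field_simps)
qed

context periodic_lti
begin

lemma dc_mag_input: "acdc_mag T u $ 1 = ereal (norm input_mean)"
proof -
  have "ess_limsup (\<lambda>t. ereal (norm (moving_avg T u t))) = ereal (norm input_mean)"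
  proof (rule ess_limsup_eq_lim[of T])
    show "continuous_on {T..} (\<lambda>t. norm (moving_avg T u t))"
      by (rule continuous_on_eq[OF continuous_on_const[of _ "norm input_mean"]]) (simp add: moving_avg_input)
    show "((\<lambda>t. norm (moving_avg T u t)) \<longlongrightarrow> norm input_mean) at_top"
      by (rule tendsto_eventually)
        (auto simp: moving_avg_input intro!: eventually_mono[OF eventually_ge_at_top[of T]])
  qed
  then show ?thesis by (simp add: acdc_mag_def)
qed

lemma dc_mag_output: "acdc_mag T y $ 1 = ereal (norm (dc_gain A B C *v input_mean))"
  using ess_limsup_eq_lim[OF continuous_on_norm[OF continuous_on_moving_avg_output]
      tendsto_norm[OF moving_avg_output_tendsto]]
  by (simp add: acdc_mag_def)

lemma continuous_on_ac_output: "continuous_on {T..} (\<lambda>t. norm (y t - moving_avg T y t))"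
  using T by (intro continuous_intros continuous_on_moving_avg_output
      continuous_on_subset[OF continuous_on_output]) auto

lemma ac_response_bound:
  assumes w: "AE s in lebesgue. s \<in> {t - T..t} \<longrightarrow> norm (u s - input_mean) \<le> c"
    and t: "T \<le> t" and c: "0 < c"
  shows "norm (ac_response t) \<le> gamma_ac A B C T * c"
proof (rule norm_le_if_inner_le)
  fix v :: "real ^ 'p" assume v: "norm v = 1"
  let ?f = "\<lambda>t. v v* H t" and ?w = "\<lambda>s. u s - input_mean"
  interpret vm: bounded_bilinear "(v*) :: real^'p \<Rightarrow> real^'m^'p \<Rightarrow> real^'m"
    by (rule bounded_bilinear_vector_matrix_mult)
  have uint: "u integrable_on {t - T..t}"
    by (intro ae_bounded_integrable ae_bounded_input)
  have wint: "?w integrable_on {t - T..t}"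
    by (intro integrable_diff uint) auto
  have "integral {t - T..t} u = T *\<^sub>R input_mean"
    using moving_avg_input[OF t, unfolded moving_avg_def, symmetric] T by simp
  then have w0: "integral {t - T..t} ?w = 0"
    using T by (subst Henstock_Kurzweil_Integration.integral_diff[OF uint]) auto
  have Hw: "(\<lambda>s. H (t - s) *v ?w s) integrable_on {t - T..t}"
    by (intro ae_bounded_integrable ae_bounded_H_input)
  \<comment> \<open>In this form the estimate is checked for each centre \<mu> separately, and no
    minimiser has to be produced.\<close>
  have "v \<bullet> ac_response t / (c * T) \<le> D_med T ?f"
  proof (rule D_med_greatest)
    fix \<mu>
    have "((\<lambda>s. v \<bullet> (H (t - s) *v ?w s) - \<mu> \<bullet> ?w s) has_integral v \<bullet> ac_response t - \<mu> \<bullet> 0) {t - T..t}"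
      unfolding ac_response_def w0[symmetric]
      by (intro has_integral_diff
          has_integral_linear[OF integrable_integral[OF Hw] bounded_linear_inner_right, unfolded o_def]
          has_integral_linear[OF integrable_integral[OF wint] bounded_linear_inner_right, unfolded o_def])
    then have I: "((\<lambda>s. (?f (t - s) - \<mu>) \<bullet> ?w s) has_integral v \<bullet> ac_response t) {t - T..t}"
      by (simp add: inner_diff_left dot_lmul_matrix)
    have "v \<bullet> ac_response t \<le> integral {t - T..t} (\<lambda>s. norm (?f (t - s) - \<mu>) * c)"
      unfolding integral_unique[OF I, symmetric]
    proof (rule integral_le_AE)
      show "AE s in lebesgue. s \<in> {t - T..t} \<longrightarrow>
          (?f (t - s) - \<mu>) \<bullet> ?w s \<le> norm (?f (t - s) - \<mu>) * c"
        using w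
      proof eventually_elim
        case (elim s)
        then show ?case
          using norm_cauchy_schwarz[of "?f (t - s) - \<mu>" "?w s"]
          by (meson mult_left_mono norm_ge_zero order_trans)
      qed
      show "(\<lambda>s. (?f (t - s) - \<mu>) \<bullet> ?w s) integrable_on {t - T..t}"
        using I by blast
      show "(\<lambda>s. norm (?f (t - s) - \<mu>) * c) integrable_on {t - T..t}"
        by (intro integrable_continuous_interval continuous_intros vm.continuous_on continuous_on_H)
    qed
    also have "\<dots> = c * integral {0..T} (\<lambda>s. norm (?f s - \<mu>))"
      using integral_reflect_window[of t T "\<lambda>s. norm (?f s - \<mu>) * c"] by simp
    finally show "v \<bullet> ac_response t / (c * T) \<le> 1 / T * integral {0..T} (\<lambda>t. norm (?f t - \<mu>))"
      using c T by (simp add: field_simps)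
  qed
  then have "v \<bullet> ac_response t \<le> (T * D_med T ?f) * c"
    using c T by (simp add: field_simps)
  also have "\<dots> \<le> gamma_ac A B C T * c"
    using c D_med_response_le_gamma_ac[OF hurwitz T v] by (intro mult_right_mono) auto
  finally show "v \<bullet> ac_response t \<le> gamma_ac A B C T * c" .
qed (use c gamma_ac_nonneg[OF hurwitz T] in \<open>auto intro: mult_nonneg_nonneg less_imp_le\<close>)

text \<open>A strict bound c on the essential limit superior is an almost everywhere bound on some
  tail. Letting c decrease to the magnitude itself is left to
  \<open>is_PAG_gain_matrix\<close>.\<close>

lemma ac_mag_output_le:
  assumes c: "acdc_mag T u $ 2 < ereal c"
  shows "acdc_mag T y $ 2 \<le> ereal (gamma_ac A B C T * c)"
proof -
  have "0 \<le> acdc_mag T u $ 2"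
    by (auto simp: acdc_mag_def intro!: ess_limsup_nonneg)
  then have c0: "0 < c" using c by (metis ereal_less(2) order.strict_trans1)
  obtain s where s: "AE t in lebesgue. s \<le> t \<longrightarrow> ereal (norm (u t - moving_avg T u t)) \<le> ereal c"
    using ess_limsup_less_imp_AE[of "\<lambda>t. ereal (norm (u t - moving_avg T u t))" "ereal c"] c
    by (auto simp: acdc_mag_def)
  \<comment> \<open>The window \<open>{t - T..t}\<close> must lie beyond s, where the bound on the
    input holds, and beyond T, where its moving average equals its mean.\<close>
  have bound: "norm (ac_response t) \<le> gamma_ac A B C T * c" if t: "max s T + T \<le> t" for t
  proof (rule ac_response_bound[OF _ _ c0])
    show "AE r in lebesgue. r \<in> {t - T..t} \<longrightarrow> norm (u r - input_mean) \<le> c"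
      using s
    proof eventually_elim
      case (elim r)
      then show ?case using t moving_avg_input[of r] by auto
    qed
  qed (use t T in linarith)
  show ?thesis
  proof (rule ereal_le_epsilon2)
    fix e :: real assume e: "0 < e"
    have "\<forall>\<^sub>F t in at_top. norm (y t - moving_avg T y t - ac_response t) < e"
      using ac_output_tendsto e by (simp add: tendsto_iff dist_norm)
    then obtain s' where s': "\<And>t. s' \<le> t \<Longrightarrow> norm (y t - moving_avg T y t - ac_response t) < e"
      unfolding eventually_at_top_linorder by blast
    define r where "r = max s' (max s T + T)"
    have "ess_limsup (\<lambda>t. ereal (norm (y t - moving_avg T y t))) \<le> ereal (gamma_ac A B C T * c + e)"
    proof (rule ess_limsup_upper)
      show "(\<lambda>t. ereal (norm (y t - moving_avg T y t))) \<in> borel_measurable (lebesgue_on {r..})"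
        using T by (intro borel_measurable_ereal continuous_imp_measurable_on_sets_lebesgue
            continuous_on_subset[OF continuous_on_ac_output]) (auto simp: r_def)
      fix t assume "r \<le> t"
      then have "norm (y t - moving_avg T y t - ac_response t) < e" "norm (ac_response t) \<le> gamma_ac A B C T * c"
        using s'[of t] bound[of t] by (auto simp: r_def)
      moreover have "norm (y t - moving_avg T y t)
          \<le> norm (y t - moving_avg T y t - ac_response t) + norm (ac_response t)"
        by (metis diff_add_cancel norm_triangle_ineq)
      ultimately show "ereal (norm (y t - moving_avg T y t)) \<le> ereal (gamma_ac A B C T * c + e)"
        by simp
    qed
    then show "acdc_mag T y $ 2 \<le> ereal (gamma_ac A B C T * c) + ereal e"
      by (simp add: acdc_mag_def)
  qed
qed

text \<open>Sampled at T, 2 T, 3 T and so on, the periodic response is constant while the transient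
  vanishes. The instant T is chosen because its window is \<open>{0..T}\<close>.\<close>

lemma ac_mag_output_ge: "ereal (norm (ac_response T)) \<le> acdc_mag T y $ 2"
proof -
  define r where "r k = T + real k * T" for k
  have r: "filterlim r at_top sequentially"
    unfolding r_def using T
    by (intro filterlim_tendsto_add_at_top[OF tendsto_const]
        filterlim_at_top_mult_tendsto_pos[OF tendsto_const] filterlim_real_sequentially)
  have per: "ac_response (r k) = ac_response T" for k
  proof (induction k)
    case (Suc k)
    have "r (Suc k) = r k + T" by (simp add: r_def algebra_simps)
    then show ?case using Suc by (simp add: ac_response_periodic)
  qed (simp add: r_def)
  have "(\<lambda>k. y (r k) - moving_avg T y (r k) - ac_response T + ac_response T)
    \<longlonglongrightarrow> 0 + ac_response T"
    using filterlim_compose[OF ac_output_tendsto r] by (intro tendsto_add tendsto_const) (simp add: per)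
  then have "(\<lambda>k. norm (y (r k) - moving_avg T y (r k))) \<longlonglongrightarrow> norm (ac_response T)"
    by (intro tendsto_norm) simp
  from ess_limsup_lower[OF continuous_on_ac_output r this]
  show ?thesis by (simp add: acdc_mag_def)
qed

end

lemma lti_system_periodic_lti:
  assumes "lti_system A B C u x0 y" "essbounded u" "hurwitz A" "0 < T" "\<And>t. u (t + T) = u t"
  obtains x where "periodic_lti A B x0 u x C T y"
proof -
  obtain x where x: "\<And>t. 0 \<le> t \<Longrightarrow> (\<lambda>s. A *v x s + B *v u s) absolutely_integrable_on {0..t} \<and>
      x t = x0 + integral {0..t} (\<lambda>s. A *v x s + B *v u s) \<and> y t = C *v x t"
    using assms(1) unfolding lti_system_def by blast
  have "periodic_lti A B x0 u x C T y"
    by unfold_locales (use x assms essbounded_ae_bounded in blast)+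
  then show ?thesis by (rule that)
qed

lemma exists_lti_system:
  fixes A :: "real ^ 'n ^ 'n" and B :: "real ^ 'm ^ 'n"
  assumes "essbounded u"
  obtains y where "lti_system A B C u x0 y"
proof -
  obtain x where "forced_lti A B x0 u x"
    using exists_solution[of u A B x0] essbounded_ae_bounded[OF assms] by blast
  then interpret forced_lti A B x0 u x .
  have "lti_system A B C u x0 (\<lambda>t. C *v x t)"
    unfolding lti_system_def using solution field_integrable by blast
  then show ?thesis by (rule that)
qed

section \<open>The exact gain\<close>

lemma essbounded_if_bounded:
  assumes "u \<in> borel_measurable lebesgue" "\<And>t. norm (u t) \<le> K"
  shows "essbounded u"
proof -
  have "esssup lebesgue (\<lambda>t. ereal (norm (u t))) \<le> ereal K"
    using assms by (intro esssup_I AE_I2) auto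
  then show ?thesis
    using assms(1) by (auto simp: essbounded_def intro: order.strict_trans1)
qed

text \<open>g 0 and g T may differ, so the periodic extension can jump at multiples of T and is only
  shown to be measurable. For the same reason its prescribed values stop short of s = T.\<close>

lemma exists_periodic_test_input:
  fixes g :: "real \<Rightarrow> real ^ 'm"
  assumes g: "continuous_on UNIV g" and g_norm: "\<And>t. norm (g t) \<le> 1"
    and T: "0 < T" and r: "0 \<le> r"
  obtains u where "essbounded u" "\<And>t. norm (u t) \<le> r" "\<And>t. u (t + T) = u t"
    "\<And>s. 0 \<le> s \<Longrightarrow> s < T \<Longrightarrow> u s = r *\<^sub>R g (T - s)"
proof
  \<comment> \<open>\<open>T * frac (t / T)\<close> folds t into the base period, and subtracting it
    from T reverses time.\<close>
  define u where "u t = r *\<^sub>R g (T - T * frac (t / T))" for t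
  show bound: "norm (u t) \<le> r" for t
    using g_norm[of "T - T * frac (t / T)"] r by (simp add: u_def mult_left_le)
  have "(\<lambda>t :: real. T - T * frac (t / T)) \<in> borel_measurable borel"
    unfolding frac_def by measurable
  from borel_measurable_continuous_on[OF g this]
  have "u \<in> borel_measurable borel"
    unfolding u_def [abs_def] by (rule borel_measurable_scaleR[OF borel_measurable_const])
  then have "u \<in> borel_measurable lebesgue"
    by (simp add: measurable_completion)
  then show "essbounded u"
    using bound by (rule essbounded_if_bounded)
  have "(t + T) / T = t / T + 1" for t
    using T by (simp add: field_simps)
  then show "u (t + T) = u t" for t
    by (simp add: u_def frac_def)
  show "u s = r *\<^sub>R g (T - s)" if "0 \<le> s" "s < T" for s
    using that T by (simp add: u_def frac_eq[THEN iffD2])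
qed

lemma gain_matrix_mult_nth:
  "(gain_matrix A B C T *v r) $ 1 = gamma_dc A B C * r $ 1"
  "(gain_matrix A B C T *v r) $ 2 = gamma_ac A B C T * r $ 2"
  by (simp_all add: gain_matrix_def matrix_vector_mult_def sum_2)

lemma acdc_mag_nonneg: "0 \<le> acdc_mag T f $ i"
proof -
  have "i = 1 \<or> i = 2" by (rule exhaust_2)
  then show ?thesis
    by (auto simp: acdc_mag_def intro!: ess_limsup_nonneg)
qed

lemma gamma_dc_nonneg: "hurwitz A \<Longrightarrow> 0 \<le> gamma_dc A B C"
  by (simp add: gamma_dc_eq onorm_pos_le mv.bounded_linear_right)

lemma is_PAG_gain_matrix:
  fixes A :: "real ^ 'n ^ 'n" and B :: "real ^ 'm ^ 'n" and C :: "real ^ 'n ^ 'p"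
  assumes hurwitz: "hurwitz A" and T: "0 < T"
  shows "is_PAG (lti_system A B C) X0 umax T (\<lambda>r. gain_matrix A B C T *v r)"
  unfolding is_PAG_def
proof (intro conjI ballI allI impI)
  note dc0 = gamma_dc_nonneg[OF hurwitz, of B C] and ac0 = gamma_ac_nonneg[OF hurwitz T, of B C]
  show "0 \<le> gain_matrix A B C T *v r" if "r \<in> gain_domain umax" for r
    using that dc0 ac0 by (auto simp: less_eq_vec_def forall_2 gain_matrix_mult_nth gain_domain_def)
  show "mono_on (gain_domain umax) ((*v) (gain_matrix A B C T))"
    using dc0 ac0
    by (auto simp: less_eq_vec_def forall_2 gain_matrix_mult_nth intro!: mono_onI mult_left_mono)
  fix u x0 y
  assume u: "u \<in> periodic_inputs T umax" and y: "lti_system A B C u x0 y"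
  then obtain x where "periodic_lti A B x0 u x C T y"
    using lti_system_periodic_lti[OF y _ hurwitz T] by (auto simp: periodic_inputs_def)
  then interpret periodic_lti A B x0 u x C T y .
  \<comment> \<open>The inequality in \<open>periodic_inputs\<close> is strict, so admissible inputs
    have finite magnitude even for \<open>umax = \<infinity>\<close>.\<close>
  have "acdc_mag T u $ 1 + acdc_mag T u $ 2 < \<infinity>"
    using u acdc_mag_nonneg[of T u]
    by (auto simp: periodic_inputs_def sum_2 intro: order.strict_trans2)
  then have "acdc_mag T u $ 2 < \<infinity>"
    using acdc_mag_nonneg[of T u] by (cases "acdc_mag T u $ 2") auto
  then obtain a where a: "acdc_mag T u $ 2 = ereal a"
    using acdc_mag_nonneg[of T u 2] by (cases "acdc_mag T u $ 2") auto
  have "norm (dc_gain A B C *v input_mean) \<le> gamma_dc A B C * norm input_mean"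
    unfolding gamma_dc_eq[OF hurwitz] by (intro onorm mv.bounded_linear_right)
  moreover have "acdc_mag T y $ 2 \<le> ereal (gamma_ac A B C T * a)"
  proof (rule ereal_le_epsilon2)
    fix e :: real assume e: "0 < e"
    \<comment> \<open>The summand 1 keeps the quotient defined when the AC gain is 0.\<close>
    define d where "d = e / (gamma_ac A B C T + 1)"
    have d: "0 < d" "gamma_ac A B C T * d \<le> e"
      using e ac0 by (auto simp: d_def field_simps)
    have "acdc_mag T y $ 2 \<le> ereal (gamma_ac A B C T * (a + d))"
      by (rule ac_mag_output_le) (use a d in simp)
    also have "\<dots> \<le> ereal (gamma_ac A B C T * a) + ereal e"
      using d by (simp add: distrib_left)
    finally show "acdc_mag T y $ 2 \<le> ereal (gamma_ac A B C T * a) + ereal e" .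
  qed
  ultimately show "acdc_mag T y \<le> ereal_vec (gain_matrix A B C T *v real_vec (acdc_mag T u))"
    by (simp add: less_eq_vec_def forall_2 ereal_vec_def real_vec_def gain_matrix_mult_nth
        dc_mag_input dc_mag_output a)
qed

text \<open>Monotonicity carries a bound from the actual magnitude of a test input up to any r above
  it. So a test input may have one magnitude equal to zero, although r has both positive and may
  itself be the magnitude of no admissible input.\<close>

lemma is_PAG_lower_bound:
  assumes pag: "is_PAG S X0 umax T \<gamma>" and r: "r \<in> gain_domain umax"
    and u: "essbounded u" "\<And>t. u (t + T) = u t"
    and mag: "acdc_mag T u $ 1 = ereal d" "acdc_mag T u $ 2 = ereal a"
    and le: "d \<le> r $ 1" "a \<le> r $ 2" "ereal (d + a) < umax"
    and S: "x0 \<in> X0" "S u x0 y"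
  shows "acdc_mag T y $ i \<le> ereal (\<gamma> r $ i)"
proof -
  let ?r = "real_vec (acdc_mag T u)"
  have nn: "0 \<le> d" "0 \<le> a"
    using acdc_mag_nonneg[of T u 1] acdc_mag_nonneg[of T u 2] mag by auto
  have "u \<in> periodic_inputs T umax"
    using u le nn by (simp add: periodic_inputs_def sum_2 mag)
  then have "acdc_mag T y \<le> ereal_vec (\<gamma> ?r)"
    using pag S unfolding is_PAG_def by blast
  then have "acdc_mag T y $ i \<le> ereal (\<gamma> ?r $ i)"
    by (simp add: less_eq_vec_def ereal_vec_def)
  moreover have comp: "?r $ 1 = d" "?r $ 2 = a"
    by (simp_all add: real_vec_def mag)
  then have "?r \<in> gain_domain umax" "?r \<le> r"
    using r le nn by (auto simp: gain_domain_def forall_2 less_eq_vec_def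
        intro: order.strict_trans1[of _ "ereal (r $ 1)"] order.strict_trans1[of _ "ereal (r $ 2)"])
  then have "\<gamma> ?r \<le> \<gamma> r"
    using pag r unfolding is_PAG_def by (auto dest: mono_onD)
  then have "\<gamma> ?r $ i \<le> \<gamma> r $ i"
    by (simp add: less_eq_vec_def)
  ultimately show ?thesis
    by (meson ereal_less_eq(3) order_trans)
qed

lemma gamma_dc_lower:
  fixes A :: "real ^ 'n ^ 'n" and B :: "real ^ 'm ^ 'n" and C :: "real ^ 'n ^ 'p"
  assumes hurwitz: "hurwitz A" and T: "0 < T" and X0: "0 \<in> X0"
    and pag: "is_PAG (lti_system A B C) X0 umax T \<gamma>" and r: "r \<in> gain_domain umax"
  shows "gamma_dc A B C * r $ 1 \<le> \<gamma> r $ 1"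
proof (cases "r $ 1 = 0")
  case True
  then show ?thesis
    using pag r by (simp add: is_PAG_def less_eq_vec_def)
next
  case False
  then have r1: "0 < r $ 1" "0 \<le> r $ 2"
    using r by (auto simp: gain_domain_def less_le)
  have "norm (dc_gain A B C *v w) \<le> \<gamma> r $ 1 / r $ 1 * norm w" for w
  proof (cases "w = 0")
    case w: False
    \<comment> \<open>A constant input has no AC part; the scaling gives it the DC magnitude
      \<open>r $ 1\<close> in the direction of w.\<close>
    define a where "a = (r $ 1 / norm w) *\<^sub>R w"
    have norm_a: "norm a = r $ 1"
      using w r1 by (simp add: a_def)
    have u: "essbounded (\<lambda>_. a)"
      by (rule essbounded_if_bounded[of _ "norm a"]) auto
    obtain y where y: "lti_system A B C (\<lambda>_. a) 0 y"
      using exists_lti_system[OF u] .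
    obtain x where "periodic_lti A B 0 (\<lambda>_. a) x C T y"
      using lti_system_periodic_lti[OF y u hurwitz T] by auto
    then interpret periodic_lti A B 0 "\<lambda>_. a" x C T y .
    have avg: "moving_avg T (\<lambda>_. a) t = a" for t
      using T by (simp add: moving_avg_def)
    then have mean: "input_mean = a"
      using moving_avg_input[of T] by simp
    have "acdc_mag T (\<lambda>_. a) $ 2 = ereal 0"
      using ess_limsup_eq_lim[of 0 "\<lambda>_. 0" 0]
      by (simp add: acdc_mag_def avg)
    from is_PAG_lower_bound[OF pag r u _ dc_mag_input this _ _ _ X0 y, of 1]
    have "norm (dc_gain A B C *v a) \<le> \<gamma> r $ 1"
      using r r1 by (simp add: mean norm_a dc_mag_output gain_domain_def)
    then show ?thesis
      using r1 w by (simp add: a_def mv.scaleR_right field_simps)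
  qed simp
  then have "gamma_dc A B C \<le> \<gamma> r $ 1 / r $ 1"
    unfolding gamma_dc_eq[OF hurwitz] by (rule onorm_le)
  then show ?thesis
    using r1 by (simp add: field_simps)
qed

lemma gamma_ac_lower:
  fixes A :: "real ^ 'n ^ 'n" and B :: "real ^ 'm ^ 'n" and C :: "real ^ 'n ^ 'p"
  assumes hurwitz: "hurwitz A" and T: "0 < T" and X0: "0 \<in> X0"
    and pag: "is_PAG (lti_system A B C) X0 umax T \<gamma>" and r: "r \<in> gain_domain umax"
  shows "gamma_ac A B C T * r $ 2 \<le> \<gamma> r $ 2"
proof (cases "r $ 2 = 0")
  case True
  then show ?thesis
    using pag r by (simp add: is_PAG_def less_eq_vec_def)
next
  case False
  then have r2: "0 \<le> r $ 1" "0 < r $ 2"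
    using r by (auto simp: gain_domain_def less_le)
  have "T * D_med T (\<lambda>t. v v* periodic_impulse_response A B C T t) \<le> \<gamma> r $ 2 / r $ 2"
    if v: "norm v = 1" for v
  proof (rule field_le_epsilon)
    fix e :: real assume e: "0 < e"
    let ?H = "periodic_impulse_response A B C T"
    let ?f = "\<lambda>t. v v* ?H t"
    interpret vm: bounded_bilinear "(v*) :: real^'p \<Rightarrow> real^'m^'p \<Rightarrow> real^'m"
      by (rule bounded_bilinear_vector_matrix_mult)
    have "continuous_on UNIV ?f"
      unfolding periodic_impulse_response_eq[OF hurwitz T]
      by (intro vm.continuous_on mm.continuous_on continuous_intros)
    then obtain g where g: "continuous_on UNIV g" "\<And>t. norm (g t) \<le> 1" "integral {0..T} g = 0"
      "T * D_med T ?f \<le> integral {0..T} (\<lambda>t. ?f t \<bullet> g t) + e / T * T"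
      using D_med_dual_approx[of ?f T "e / T"] T e by auto
    obtain u where u: "essbounded u" "\<And>t. norm (u t) \<le> r $ 2" "\<And>t. u (t + T) = u t"
      "\<And>s. 0 \<le> s \<Longrightarrow> s < T \<Longrightarrow> u s = r $ 2 *\<^sub>R g (T - s)"
      using exists_periodic_test_input[OF g(1,2) T, of "r $ 2"] r2 by auto
    obtain y where y: "lti_system A B C u 0 y"
      using exists_lti_system[OF u(1)] .
    obtain x where "periodic_lti A B 0 u x C T y"
      using lti_system_periodic_lti[OF y u(1) hurwitz T u(3)] by auto
    then interpret periodic_lti A B 0 u x C T y .
    \<comment> \<open>Time reversal of the input turns the convolution at time T into a pairing of
      the kernel with g. The end point T, where u need not equal the reversed g, is a null
      set.\<close>
    have reflect: "integral {0..T} (\<lambda>s. F (T - s) (u s)) = integral {0..T} (\<lambda>s. F s (r $ 2 *\<^sub>R g s))"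
      for F :: "real \<Rightarrow> real^'m \<Rightarrow> 'z::euclidean_space"
    proof -
      have "integral {0..T} (\<lambda>s. F (T - s) (u s)) = integral {0..T} (\<lambda>s. F (T - s) (r $ 2 *\<^sub>R g (T - s)))"
        by (rule integral_spike[of "{T}"]) (auto simp: u(4))
      then show ?thesis
        using integral_reflect_window[of T T "\<lambda>s. F s (r $ 2 *\<^sub>R g s)"] by simp
    qed
    have mean: "input_mean = 0"
      using reflect[of "\<lambda>_ w. w"] g(3) by (simp add: input_mean_def)
    have "acdc_mag T u $ 2 \<le> ereal (r $ 2)"
    proof -
      have "(\<lambda>t. ereal (norm (u t))) \<in> borel_measurable (lebesgue_on {T..})"
        using ae_bounded_input[of "{T..}"] by (auto simp: ae_bounded_def)
      then have "(\<lambda>t. ereal (norm (u t - moving_avg T u t))) \<in> borel_measurable (lebesgue_on {T..})"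
        by (rule measurable_cong[THEN iffD1, rotated]) (simp add: moving_avg_input mean)
      then show ?thesis
        unfolding acdc_mag_def using u(2)
        by (simp, intro ess_limsup_upper[of _ T]) (auto simp: moving_avg_input mean)
    qed
    \<comment> \<open>Only an upper bound on the AC magnitude is established; monotonicity of the
      gain absorbs a smaller value.\<close>
    then obtain a where a: "acdc_mag T u $ 2 = ereal a" "a \<le> r $ 2"
      using acdc_mag_nonneg[of T u 2] by (cases "acdc_mag T u $ 2") auto
    have "ereal a < umax"
      using a(2) r by (auto simp: gain_domain_def intro: order.strict_trans1[of _ "ereal (r $ 2)"])
    with is_PAG_lower_bound[OF pag r u(1,3) dc_mag_input a(1) _ a(2) _ X0 y, of 2]
    have "acdc_mag T y $ 2 \<le> ereal (\<gamma> r $ 2)"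
      using r2 by (simp add: mean)
    then have le: "norm (ac_response T) \<le> \<gamma> r $ 2"
      using ac_mag_output_ge by (meson ereal_less_eq(3) order_trans)
    have "ac_response T = integral {0..T} (\<lambda>s. ?H s *v (r $ 2 *\<^sub>R g s))"
      using reflect[of "\<lambda>s w. ?H s *v w"] by (simp add: ac_response_def mean)
    moreover have int: "(\<lambda>s. ?H s *v (r $ 2 *\<^sub>R g s)) integrable_on {0..T}"
      by (intro integrable_continuous_interval mv.continuous_on continuous_on_H continuous_intros
          continuous_on_subset[OF g(1)]) auto
    ultimately have "v \<bullet> ac_response T = integral {0..T} (\<lambda>s. v \<bullet> (?H s *v (r $ 2 *\<^sub>R g s)))"
      using integral_linear[OF int bounded_linear_inner_right[of v]] by (simp add: o_def)
    also have "\<dots> = r $ 2 * integral {0..T} (\<lambda>t. ?f t \<bullet> g t)"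
      by (simp add: dot_lmul_matrix mv.scaleR_right)
    finally have "r $ 2 * integral {0..T} (\<lambda>t. ?f t \<bullet> g t) \<le> \<gamma> r $ 2"
      using le norm_cauchy_schwarz[of v "ac_response T"] v by simp
    then have "integral {0..T} (\<lambda>t. ?f t \<bullet> g t) \<le> \<gamma> r $ 2 / r $ 2"
      using r2 by (simp add: field_simps)
    then show "T * D_med T ?f \<le> \<gamma> r $ 2 / r $ 2 + e"
      using g(4) T by simp
  qed
  then have "gamma_ac A B C T \<le> \<gamma> r $ 2 / r $ 2"
    by (rule gamma_ac_le[OF T])
  then show ?thesis
    using r2 by (simp add: field_simps)
qed

theorem theorem1:
  fixes A :: "real ^ 'n ^ 'n" and B :: "real ^ 'm ^ 'n" and C :: "real ^ 'n ^ 'p"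
    and X0 :: "(real ^ 'n) set" and umax :: ereal and T :: real
  assumes "hurwitz A"
    and "open X0" and "0 \<in> X0"
    and "0 < umax"
    and "0 < T"
  shows "invertible (mat 1 - matrix_exp (T *\<^sub>R A)) \<and>
    (\<forall>t\<in>{0..T}. (\<lambda>k. C ** matrix_exp ((t + real k * T) *\<^sub>R A) ** B) sums
       (C ** matrix_exp (t *\<^sub>R A) ** matrix_inv (mat 1 - matrix_exp (T *\<^sub>R A)) ** B)) \<and>
    is_exact_PAG (lti_system A B C) X0 umax T (\<lambda>r. gain_matrix A B C T *v r)"
proof (intro conjI ballI)
  let ?\<Gamma> = "\<lambda>r. gain_matrix A B C T *v r" and ?P = "is_PAG (lti_system A B C) X0 umax T"
  have pag: "?P ?\<Gamma>"
    using assms by (intro is_PAG_gain_matrix)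
  have lower: "?\<Gamma> r $ i \<le> \<gamma> r $ i" if "?P \<gamma>" "r \<in> gain_domain umax" for \<gamma> r i
    using gamma_dc_lower[OF assms(1,5,3) that] gamma_ac_lower[OF assms(1,5,3) that] exhaust_2[of i]
    by (auto simp: gain_matrix_mult_nth)
  \<comment> \<open>The linear gain is itself conservative and lies below every conservative gain,
    so the infimum is attained; the bound from below is also what makes the real \<open>INF\<close>
    meaningful.\<close>
  have "?\<Gamma> r $ i = (INF \<gamma>\<in>{\<gamma>. ?P \<gamma>}. \<gamma> r $ i)" if r: "r \<in> gain_domain umax" for r i
  proof (rule antisym)
    show "?\<Gamma> r $ i \<le> (INF \<gamma>\<in>{\<gamma>. ?P \<gamma>}. \<gamma> r $ i)"
      using pag lower r by (intro cINF_greatest) auto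
    have "bdd_below ((\<lambda>\<gamma>. \<gamma> r $ i) ` {\<gamma>. ?P \<gamma>})"
      using lower r by (intro bdd_belowI2[of _ "?\<Gamma> r $ i"]) auto
    then show "(INF \<gamma>\<in>{\<gamma>. ?P \<gamma>}. \<gamma> r $ i) \<le> ?\<Gamma> r $ i"
      by (rule cINF_lower) (simp add: pag)
  qed
  then show "is_exact_PAG (lti_system A B C) X0 umax T ?\<Gamma>"
    using pag unfolding is_exact_PAG_def by blast
qed (use assms hurwitz_invertible_one_minus_exp hurwitz_periodic_impulse_sums in auto)

end
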